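(* Let $\alpha\in(0,1)$, let $C>0$ be a constant, and let $M$ be a probability measure on $B_+^{d-1}$, the set of unit vectors of $\mathbb{R}^d$ with nonnegative components. For $\epsilon>0$ consider the $d$-dimensional subordinator whose Lévy measure, in spherical variables $(\rho,\theta)\in(0,\infty)\times B_+^{d-1}$, is $$\nu_\epsilon(d\rho,d\theta)=C(\rho-\epsilon)^{-\alpha}\rho^{-1}1_{\rho\ge\epsilon}\,d\rho\,M(d\theta).$$ Then, for a constant $k$, its multivariate Bernstein function is, for $\eta=(\eta_1,\dots,\eta_d)$ with nonnegative components, $$\Phi_\epsilon(\eta)=k\int_{B_+^{d-1}}(\theta\cdot\eta)^\alpha\,O_\epsilon(\eta\cdot\theta)\,M(d\theta),$$ where the corrective term $$O_\epsilon(\eta\cdot\theta)=\frac{\alpha}{\epsilon^\alpha}\int_0^\epsilon e^{-\eta\cdot\theta\, y}\,y^{\alpha-1}\,dy$$ tends to $1$ as $\epsilon\to0$. Moreover the density $q_\epsilon(x,t)$ of the process satisfies $$\frac{\partial}{\partial t}q_\epsilon(x,t)=-k\int_{B_+^{d-1}}(\nabla_x\cdot\theta)^\alpha\,O_\epsilon(\theta\cdot\nabla_x)\,q_\epsilon(x,t)\,M(d\theta),$$ where $$O_\epsilon(\theta\cdot\nabla_x)h(x):=\frac{\alpha}{\epsilon^\alpha}\int_0^\epsilon e^{-y\,\theta\cdot\nabla_x}h(x)\,y^{\alpha-1}\,dy=\frac{\alpha}{\epsilon^\alpha}\int_0^\epsilon h(x-y\theta)\,y^{\alpha-1}\,dy$$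 tends to the identity operator as $\epsilon\to0$.
   Context: A $d$-dimensional (multivariate) subordinator is a $d$-dimensional Lévy process $(S_1,\dots,S_d)$ with increasing marginal components, here with $\mathbb{E}e^{-(\eta_1S_1(t)+\dots+\eta_dS_d(t))}=e^{-t\Phi(\eta)}$, where the multivariate Bernstein function is $\Phi(\eta)=\int_{\mathbb{R}_+^d}(1-e^{-\eta\cdot x})\,\nu(dx)$ and $\nu$ is the Lévy measure. The fractional directional derivative along the unit vector $\theta$ is $$(\nabla_x\cdot\theta)^\alpha h(x):=k\int_0^\infty\bigl(h(x)-h(x-r\theta)\bigr)r^{-\alpha-1}\,dr.$$ Throughout, $k$ denotes a constant whose value is left unspecified and which need not be the same at each occurrence; $\cdot$ is the scalar product, and $e^{-y\,\theta\cdot\nabla_x}$ is the translation operator $h(x)\mapsto h(x-y\theta)$.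
   Formalization: The Lévy measure is finite, so the process has an atom at the origin and no density exists; q_ε(·,t) is read as the law of the process, and the evolution equation is proved weakly, for t>0, against bounded Lipschitz test functions. *)

theory Defs
  imports "HOL-Probability.Probability"
begin

section \<open>Multivariate subordinators\<close>

definition levy_process :: "'w measure \<Rightarrow> (real \<Rightarrow> 'w \<Rightarrow> real ^ 'd) \<Rightarrow> bool" where
  "levy_process P S \<longleftrightarrow>
     prob_space P \<and>
     (\<forall>t\<ge>0. S t \<in> borel_measurable P) \<and>
     (AE w in P. S 0 w = 0) \<and>
     (\<forall>n (\<tau> :: nat \<Rightarrow> real). 0 \<le> \<tau> 0 \<and> (\<forall>i<n. \<tau> i \<le> \<tau> (Suc i)) \<longrightarrow>
        prob_space.indep_vars P (\<lambda>_. borel) (\<lambda>i w. S (\<tau> (Suc i)) w - S (\<tau> i) w) {..<n}) \<and>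
     (\<forall>s\<ge>0. \<forall>t\<ge>0. distr P borel (\<lambda>w. S (s + t) w - S s w) = distr P borel (S t)) \<and>
     (AE w in P. (\<forall>t\<ge>0. ((\<lambda>s. S s w) \<longlongrightarrow> S t w) (at_right t)) \<and>
                 (\<forall>t>0. \<exists>l. ((\<lambda>s. S s w) \<longlongrightarrow> l) (at_left t)))"

definition subordinator :: "'w measure \<Rightarrow> (real \<Rightarrow> 'w \<Rightarrow> real ^ 'd) \<Rightarrow> bool" where
  "subordinator P S \<longleftrightarrow>
     levy_process P S \<and> (AE w in P. \<forall>i. mono_on {0..} (\<lambda>t. S t w $ i))"

definition nonneg_vec :: "real ^ 'd \<Rightarrow> bool" where
  "nonneg_vec x \<longleftrightarrow> (\<forall>i. 0 \<le> x $ i)"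

definition bernstein :: "(real ^ 'd) measure \<Rightarrow> real ^ 'd \<Rightarrow> real" where
  "bernstein \<nu> \<eta> = (\<integral>x. 1 - exp (- (\<eta> \<bullet> x)) \<partial>\<nu>)"

text \<open>The subordinator has no drift, so its Laplace exponent is the Bernstein function of its
  Levy measure. The Levy measure is a measure on all of the space that lives on the nonnegative
  orthant without the origin.\<close>

definition has_levy_measure ::
    "'w measure \<Rightarrow> (real \<Rightarrow> 'w \<Rightarrow> real ^ 'd) \<Rightarrow> (real ^ 'd) measure \<Rightarrow> bool" where
  "has_levy_measure P S \<nu> \<longleftrightarrow>
     sets \<nu> = sets borel \<and>
     (AE x in \<nu>. nonneg_vec x \<and> x \<noteq> 0) \<and>
     (\<integral>\<^sup>+x. ennreal (min 1 (norm x)) \<partial>\<nu>) < \<infinity> \<and>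
     (\<forall>t\<ge>0. \<forall>\<eta>. nonneg_vec \<eta> \<longrightarrow>
        (\<integral>w. exp (- (\<eta> \<bullet> S t w)) \<partial>P) = exp (- t * bernstein \<nu> \<eta>))"

definition Bplus :: "(real ^ 'd) set" where
  "Bplus = {\<theta>. norm \<theta> = 1 \<and> nonneg_vec \<theta>}"

text \<open>The measure given in spherical variables, transported by \<open>(\<rho>, \<theta>) \<mapsto> \<rho> \<theta>\<close>.\<close>

definition nu_eps :: "real \<Rightarrow> real \<Rightarrow> real \<Rightarrow> (real ^ 'd) measure \<Rightarrow> (real ^ 'd) measure" where
  "nu_eps \<alpha> C \<epsilon> M =
     distr (density lborel (\<lambda>\<rho>. ennreal (C * (\<rho> - \<epsilon>) powr (- \<alpha>) * (1 / \<rho>) * indicator {\<epsilon>..} \<rho>))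
              \<Otimes>\<^sub>M M)
       borel (\<lambda>(\<rho>, \<theta>). \<rho> *\<^sub>R \<theta>)"

definition corrective :: "real \<Rightarrow> real \<Rightarrow> real \<Rightarrow> real" where
  "corrective \<alpha> \<epsilon> s = \<alpha> / \<epsilon> powr \<alpha> * (LBINT y:{0..\<epsilon>}. exp (- s * y) * y powr (\<alpha> - 1))"

section \<open>Operators on functions\<close>

text \<open>\<open>transl y \<theta>\<close> is \<open>exp (- y \<theta> \<cdot> \<nabla>)\<close>. The number \<open>c\<close> in
  \<open>frac_deriv\<close> is the unspecified constant in front of the fractional derivative.\<close>

definition transl :: "real \<Rightarrow> 'a \<Rightarrow> ('a::euclidean_space \<Rightarrow> real) \<Rightarrow> 'a \<Rightarrow> real" where
  "transl y \<theta> h = (\<lambda>x. h (x - y *\<^sub>R \<theta>))"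

definition frac_deriv ::
    "real \<Rightarrow> real \<Rightarrow> 'a \<Rightarrow> ('a::euclidean_space \<Rightarrow> real) \<Rightarrow> 'a \<Rightarrow> real" where
  "frac_deriv c \<alpha> \<theta> h x = c * (LBINT r:{0<..}. (h x - h (x - r *\<^sub>R \<theta>)) * r powr (- \<alpha> - 1))"

definition corr_op ::
    "real \<Rightarrow> real \<Rightarrow> 'a \<Rightarrow> ('a::euclidean_space \<Rightarrow> real) \<Rightarrow> 'a \<Rightarrow> real" where
  "corr_op \<alpha> \<epsilon> \<theta> h x =
     \<alpha> / \<epsilon> powr \<alpha> * (LBINT y:{0..\<epsilon>}. transl y \<theta> h x * y powr (\<alpha> - 1))"

section \<open>The same operators on generalised functions\<close>

text \<open>The measure \<open>nu_eps\<close> is finite, so the process is compound Poisson and its law at time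
  \<open>t\<close> has an atom at the origin: the density exists only as a generalised function.
  A generalised function is represented by its pairing with test functions. Finite measures
  pair with all bounded Lipschitz functions, a class that contains the smooth functions with
  compact support. Translation is extended by duality; the other two operators are the formulas
  of the previous section with the integrals taken weakly. The lemmas below check that on
  generalised functions given by ordinary functions nothing changes.\<close>

type_synonym 'a gfun = "('a \<Rightarrow> real) \<Rightarrow> real"

definition test_fun :: "('a::euclidean_space \<Rightarrow> real) \<Rightarrow> bool" where
  "test_fun \<phi> \<longleftrightarrow> bounded (range \<phi>) \<and> (\<exists>L. L-lipschitz_on UNIV \<phi>)"

definition gfun_of_fun :: "('a::euclidean_space \<Rightarrow> real) \<Rightarrow> 'a gfun" where
  "gfun_of_fun h \<phi> = (\<integral>x. h x * \<phi> x \<partial>lborel)"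

definition gfun_of_measure :: "'a::euclidean_space measure \<Rightarrow> 'a gfun" where
  "gfun_of_measure \<mu> \<phi> = (\<integral>x. \<phi> x \<partial>\<mu>)"

definition gdensity :: "'w measure \<Rightarrow> (real \<Rightarrow> 'w \<Rightarrow> real ^ 'd) \<Rightarrow> real \<Rightarrow> (real ^ 'd) gfun" where
  "gdensity P S t = gfun_of_measure (distr P borel (S t))"

definition gtransl :: "real \<Rightarrow> 'a \<Rightarrow> 'a::euclidean_space gfun \<Rightarrow> 'a gfun" where
  "gtransl y \<theta> T = (\<lambda>\<phi>. T (\<lambda>x. \<phi> (x + y *\<^sub>R \<theta>)))"

definition gfrac_deriv :: "real \<Rightarrow> real \<Rightarrow> 'a \<Rightarrow> 'a::euclidean_space gfun \<Rightarrow> 'a gfun" where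
  "gfrac_deriv c \<alpha> \<theta> T \<phi> = c * (LBINT r:{0<..}. (T \<phi> - gtransl r \<theta> T \<phi>) * r powr (- \<alpha> - 1))"

definition gcorr_op :: "real \<Rightarrow> real \<Rightarrow> 'a \<Rightarrow> 'a::euclidean_space gfun \<Rightarrow> 'a gfun" where
  "gcorr_op \<alpha> \<epsilon> \<theta> T \<phi> =
     \<alpha> / \<epsilon> powr \<alpha> * (LBINT y:{0..\<epsilon>}. gtransl y \<theta> T \<phi> * y powr (\<alpha> - 1))"

lemma gfun_of_measure_density:
  assumes "q \<in> borel_measurable borel" "\<And>x. 0 \<le> q x" "\<phi> \<in> borel_measurable borel"
  shows "gfun_of_measure (density lborel (\<lambda>x. ennreal (q x))) \<phi> = gfun_of_fun q \<phi>"
  unfolding gfun_of_measure_def gfun_of_fun_def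
  using assms by (subst integral_density) auto

lemma gtransl_gfun_of_fun: "gtransl y \<theta> (gfun_of_fun h) = gfun_of_fun (transl y \<theta> h)"
proof
  fix \<phi> :: "'a \<Rightarrow> real"
  have "(\<integral>x. h (x - y *\<^sub>R \<theta>) * \<phi> x \<partial>lborel) = (\<integral>x. h x * \<phi> (x + y *\<^sub>R \<theta>) \<partial>lborel)"
  proof -
    have eq: "lborel = distr lborel lborel (\<lambda>x. y *\<^sub>R \<theta> + x)"
      using lborel_distr_plus[of "y *\<^sub>R \<theta>"] by (simp cong: distr_cong)
    have me: "(\<lambda>x. - (y *\<^sub>R \<theta>) + x) \<in> measurable lborel (lborel :: 'a measure)" by simp
    let ?f = "\<lambda>x. h (x - y *\<^sub>R \<theta>) * \<phi> x"
    show ?thesis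
    proof (cases "?f \<in> borel_measurable lborel")
      case True
      then show ?thesis
        by (subst eq, subst integral_distr) (auto simp: add.commute)
    next
      case False
      have "(\<lambda>x. h x * \<phi> (x + y *\<^sub>R \<theta>)) \<notin> borel_measurable lborel"
      proof
        assume "(\<lambda>x. h x * \<phi> (x + y *\<^sub>R \<theta>)) \<in> borel_measurable lborel"
        from measurable_compose[OF me this] False show False by simp
      qed
      then show ?thesis
        using False borel_measurable_integrable not_integrable_integral_eq by metis
    qed
  qed
  then show "gtransl y \<theta> (gfun_of_fun h) \<phi> = gfun_of_fun (transl y \<theta> h) \<phi>"
    by (simp add: gtransl_def gfun_of_fun_def transl_def)
qed

lemma swap_integrals:
  fixes F :: "real \<Rightarrow> 'a::euclidean_space \<Rightarrow> real"
  assumes F: "(\<lambda>(r, x). F r x) \<in> borel_measurable (borel \<Otimes>\<^sub>M borel)"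
    and w: "integrable lborel w" and \<phi>: "integrable lborel \<phi>"
    and le: "\<And>r x. \<bar>F r x\<bar> \<le> w r * \<bar>\<phi> x\<bar>"
  shows "(\<integral>r. (\<integral>x. F r x \<partial>lborel) \<partial>lborel) = (\<integral>x. (\<integral>r. F r x \<partial>lborel) \<partial>lborel)"
proof -
  have m: "(\<lambda>(r, x). F r x) \<in> borel_measurable (lborel \<Otimes>\<^sub>M lborel)"
    using F by (simp cong: measurable_cong_sets)
  have "integrable (lborel \<Otimes>\<^sub>M lborel) (\<lambda>(r, x). w r * \<bar>\<phi> x\<bar>)"
    using w \<phi> by (intro lborel_pair.Fubini_integrable) (auto simp: abs_mult)
  then have "integrable (lborel \<Otimes>\<^sub>M lborel) (\<lambda>(r, x). F r x)"
    by (rule Bochner_Integration.integrable_bound[OF _ m])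
       (use le in \<open>auto intro!: AE_I2 order.trans[OF le]\<close>)
  from lborel_pair.Fubini_integral[OF this] show ?thesis by simp
qed

lemma gcorr_op_gfun_of_fun:
  fixes h \<phi> :: "'a::euclidean_space \<Rightarrow> real"
  assumes "0 < \<alpha>" "0 < \<epsilon>" "h \<in> borel_measurable borel" "bounded (range h)"
    and \<phi>: "integrable lborel \<phi>"
  shows "gcorr_op \<alpha> \<epsilon> \<theta> (gfun_of_fun h) \<phi> = gfun_of_fun (corr_op \<alpha> \<epsilon> \<theta> h) \<phi>"
proof -
  obtain B where B: "\<And>x. \<bar>h x\<bar> \<le> B" using assms(4) by (auto simp: bounded_iff)
  define u where "u = (\<lambda>y. indicator {0..\<epsilon>} y * y powr (\<alpha> - 1) :: real)"
  have u: "integrable lborel u"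
  proof -
    have "(\<lambda>y. y powr (\<alpha> - 1)) absolutely_integrable_on {0..\<epsilon>}"
      by (rule nonnegative_absolutely_integrable_1)
         (use has_integral_powr_from_0[of "\<alpha> - 1" \<epsilon>] assms in \<open>auto simp: integrable_on_def\<close>)
    then have "set_integrable lborel {0..\<epsilon>} (\<lambda>y. y powr (\<alpha> - 1))"
      unfolding set_integrable_def by (subst (asm) integrable_completion) auto
    then show ?thesis by (simp add: set_integrable_def u_def)
  qed
  have [measurable]: "\<phi> \<in> borel_measurable borel" "h \<in> borel_measurable borel"
    using \<phi> assms(3) by auto
  have [measurable]: "u \<in> borel_measurable borel" using u by auto
  have "(\<integral>y. (\<integral>x. u y * (h (x - y *\<^sub>R \<theta>) * \<phi> x) \<partial>lborel) \<partial>lborel)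
      = (\<integral>x. (\<integral>y. u y * (h (x - y *\<^sub>R \<theta>) * \<phi> x) \<partial>lborel) \<partial>lborel)"
  proof (rule swap_integrals[where w = "\<lambda>y. B * u y" and \<phi> = \<phi>])
    fix y x
    have "0 \<le> u y" by (simp add: u_def)
    then have "u y * (\<bar>h (x - y *\<^sub>R \<theta>)\<bar> * \<bar>\<phi> x\<bar>) \<le> u y * (B * \<bar>\<phi> x\<bar>)"
      by (intro mult_left_mono mult_right_mono B) auto
    with \<open>0 \<le> u y\<close> show "\<bar>u y * (h (x - y *\<^sub>R \<theta>) * \<phi> x)\<bar> \<le> B * u y * \<bar>\<phi> x\<bar>"
      by (simp add: abs_mult mult_ac)
  qed (use u \<phi> in \<open>auto\<close>)
  then show ?thesis
    unfolding gcorr_op_def gtransl_gfun_of_fun gfun_of_fun_def corr_op_def transl_def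
      set_lebesgue_integral_def
    by (simp add: u_def mult_ac flip: integral_mult_right_zero)
qed

lemma gfrac_deriv_gfun_of_fun:
  fixes h \<phi> :: "'a::euclidean_space \<Rightarrow> real"
  assumes "0 < \<alpha>" "\<alpha> < 1" "test_fun h" and \<phi>: "integrable lborel \<phi>"
  shows "gfrac_deriv c \<alpha> \<theta> (gfun_of_fun h) \<phi> = gfun_of_fun (frac_deriv c \<alpha> \<theta> h) \<phi>"
proof -
  obtain B where B: "\<And>x. \<bar>h x\<bar> \<le> B" using assms(3) by (auto simp: bounded_iff test_fun_def)
  obtain L where L: "L-lipschitz_on UNIV h" using assms(3) by (auto simp: test_fun_def)
  have "continuous_on UNIV h" using L by (rule lipschitz_on_continuous_on)
  then have [measurable]: "h \<in> borel_measurable borel" by (rule borel_measurable_continuous_onI)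
  have [measurable]: "\<phi> \<in> borel_measurable borel" using \<phi> by auto
  have B0: "0 \<le> B" using B[of 0] by linarith
  have L0: "0 \<le> L" using L by (rule lipschitz_on_nonneg)
  define w where "w = (\<lambda>r. L * norm \<theta> * (indicator {0..1} r * r powr (- \<alpha>))
      + 2 * B * (indicator {1..} r * r powr (- \<alpha> - 1)) :: real)"
  have "(\<lambda>r. r powr (- \<alpha>)) absolutely_integrable_on {0..1}"
    by (rule nonnegative_absolutely_integrable_1)
       (use has_integral_powr_from_0[of "- \<alpha>" 1] assms in \<open>auto simp: integrable_on_def\<close>)
  then have w1: "integrable lborel (\<lambda>r::real. indicator {0..1} r * r powr (- \<alpha>))"
    unfolding set_integrable_def by (subst (asm) integrable_completion) auto
  have "(\<lambda>r. r powr (- \<alpha> - 1)) absolutely_integrable_on {1..}"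
    by (rule nonnegative_absolutely_integrable_1)
       (use has_integral_powr_to_inf[of "- \<alpha> - 1" 1] assms in \<open>auto simp: integrable_on_def\<close>)
  then have w2: "integrable lborel (\<lambda>r::real. indicator {1..} r * r powr (- \<alpha> - 1))"
    unfolding set_integrable_def by (subst (asm) integrable_completion) auto
  have w: "integrable lborel w"
    unfolding w_def using w1 w2 by auto
  have key: "indicator {0<..} r * r powr (- \<alpha> - 1) * \<bar>h x - h (x - r *\<^sub>R \<theta>)\<bar> \<le> w r" for r x
  proof (cases "0 < r")
    case True
    show ?thesis
    proof (cases "r \<le> 1")
      case r1: True
      have "\<bar>h x - h (x - r *\<^sub>R \<theta>)\<bar> \<le> L * (r * norm \<theta>)"
        using lipschitz_onD[OF L, of x "x - r *\<^sub>R \<theta>"] True by (simp add: dist_norm)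
      then have "r powr (- \<alpha> - 1) * \<bar>h x - h (x - r *\<^sub>R \<theta>)\<bar> \<le> r powr (- \<alpha> - 1) * (L * (r * norm \<theta>))"
        by (rule mult_left_mono) simp
      also have "\<dots> = L * norm \<theta> * r powr (- \<alpha>)"
        using True by (simp add: powr_diff)
      also have "\<dots> \<le> w r"
        using True r1 B0 by (simp add: w_def)
      finally show ?thesis using True by simp
    next
      case False
      have "\<bar>h x - h (x - r *\<^sub>R \<theta>)\<bar> \<le> 2 * B"
        using B[of x] B[of "x - r *\<^sub>R \<theta>"] by linarith
      then have "r powr (- \<alpha> - 1) * \<bar>h x - h (x - r *\<^sub>R \<theta>)\<bar> \<le> r powr (- \<alpha> - 1) * (2 * B)"
        by (rule mult_left_mono) simp
      then show ?thesis using False True by (simp add: w_def mult_ac)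
    qed
  next
    case False
    then show ?thesis using L0 B0 by (simp add: w_def)
  qed
  have hint: "integrable lborel (\<lambda>x. h (x - v) * \<phi> x)" for v
  proof (rule Bochner_Integration.integrable_bound[of _ "\<lambda>x. B * \<phi> x"])
    show "AE x in lborel. norm (h (x - v) * \<phi> x) \<le> norm (B * \<phi> x)"
      using B B0 by (auto simp: abs_mult intro!: mult_right_mono)
  qed (use \<phi> in auto)
  have diff: "gfun_of_fun h \<phi> - gfun_of_fun (transl r \<theta> h) \<phi>
      = (\<integral>x. (h x - h (x - r *\<^sub>R \<theta>)) * \<phi> x \<partial>lborel)" for r
    using hint[of 0] hint[of "r *\<^sub>R \<theta>"]
    by (simp add: gfun_of_fun_def transl_def left_diff_distrib)
  have "(\<integral>r. (\<integral>x. indicator {0<..} r * r powr (- \<alpha> - 1) * (h x - h (x - r *\<^sub>R \<theta>)) * \<phi> x \<partial>lborel) \<partial>lborel)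
      = (\<integral>x. (\<integral>r. indicator {0<..} r * r powr (- \<alpha> - 1) * (h x - h (x - r *\<^sub>R \<theta>)) * \<phi> x \<partial>lborel) \<partial>lborel)"
  proof (rule swap_integrals[where w = w and \<phi> = \<phi>])
    fix r x
    show "\<bar>indicator {0<..} r * r powr (- \<alpha> - 1) * (h x - h (x - r *\<^sub>R \<theta>)) * \<phi> x\<bar> \<le> w r * \<bar>\<phi> x\<bar>"
      using mult_right_mono[OF key[of r x], of "\<bar>\<phi> x\<bar>"] by (simp add: abs_mult)
  qed (use w \<phi> in \<open>auto\<close>)
  then show ?thesis
    unfolding gfrac_deriv_def gtransl_gfun_of_fun diff frac_deriv_def set_lebesgue_integral_def
    unfolding gfun_of_fun_def
    by (simp add: mult_ac flip: integral_mult_right_zero)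
qed

end

(* Along a ray the Levy kernel (rho - eps)^(-alpha) / rho arises from the Marchaud derivative of a
   power-weighted average: with r = y s the double integral of
   (f y - f (r + y)) y^(alpha-1) r^(-alpha-1) over r > 0, 0 < y < eps turns into a Frullani
   integral, because y^(alpha-1) r^(-alpha-1) dr = s^(-alpha-1) ds / y. For f = exp (- s .) this
   gives the Bernstein function; for f r = E phi (S_t + r theta) it turns the right-hand side of
   the evolution equation into the generator applied to the law of S_t.
   The forward equation holds for exponential sums by the Laplace transform. It extends to bounded
   continuous functions since the second-order Taylor bound for t -> E p (S_t) involves only the
   supremum of p on the orthant, hence survives bounded pointwise limits, and exponential sums
   are dense in this sense by Stone-Weierstrass after the substitution u = exp (- x). *)

theory Submission
  imports Defs
begin

section \<open>Power-weighted averages and the Marchaud derivative\<close>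

text \<open>The difficulty along a ray lies in the interchanges of integrals: f is only bounded and
  Lipschitz, and each of the three swaps in \<open>marchaud_average_eq\<close> needs a majorant that
  is a product of a function of one variable and a function of the other. No single estimate of the
  difference of f is integrable at both ends, so Lipschitz and sup bounds are combined differently
  in each swap. The normalisation \<alpha> / \<epsilon> powr \<alpha> of the average cancels exactly
  against the factor \<epsilon> powr \<alpha> / \<alpha> left by the last inner integral. This is
  why the constants k do not depend on \<epsilon>: they are C Gamma(1 - \<alpha>) / \<alpha> for the
  Bernstein function and C / c for the evolution equation. For fixed \<epsilon> > 0 the Levy measure
  is finite, so the generator is bounded for the supremum on the orthant. This gives the second time
  derivative a bound free of derivatives of the test function and removes all questions of
  domains.\<close>

lemma powr_integrable_from_0:
  fixes a c :: real
  assumes "-1 < a" "0 \<le> c"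
  shows "set_integrable lborel {0..c} (\<lambda>y. y powr a)"
    and "(LBINT y:{0..c}. y powr a) = c powr (a + 1) / (a + 1)"
proof -
  have *: "((\<lambda>y. y powr a) has_integral (c powr (a + 1) / (a + 1))) {0..c}"
    using has_integral_powr_from_0[of a c] assms by simp
  then have "(\<lambda>y. y powr a) absolutely_integrable_on {0..c}"
    by (intro nonnegative_absolutely_integrable_1) (auto simp: integrable_on_def)
  then show i: "set_integrable lborel {0..c} (\<lambda>y. y powr a)"
    unfolding set_integrable_def by (subst (asm) integrable_completion) auto
  show "(LBINT y:{0..c}. y powr a) = c powr (a + 1) / (a + 1)"
    using set_borel_integral_eq_integral(2)[OF i] * by (simp add: integral_unique)
qed

lemma powr_integrable_to_inf:
  fixes a c :: real
  assumes "a < -1" "0 < c"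
  shows "set_integrable lborel {c..} (\<lambda>y. y powr a)"
    and "(LBINT y:{c..}. y powr a) = - (c powr (a + 1)) / (a + 1)"
proof -
  have *: "((\<lambda>y. y powr a) has_integral - (c powr (a + 1)) / (a + 1)) {c..}"
    using has_integral_powr_to_inf[of a c] assms by simp
  then have "(\<lambda>y. y powr a) absolutely_integrable_on {c..}"
    by (intro nonnegative_absolutely_integrable_1) (auto simp: integrable_on_def)
  then show i: "set_integrable lborel {c..} (\<lambda>y. y powr a)"
    unfolding set_integrable_def by (subst (asm) integrable_completion) auto
  show "(LBINT y:{c..}. y powr a) = - (c powr (a + 1)) / (a + 1)"
    using set_borel_integral_eq_integral(2)[OF i] * by (simp add: integral_unique)
qed

lemma set_integrable_bounded_mult:
  fixes f w :: "'a \<Rightarrow> real"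
  assumes w: "set_integrable N A w" and f: "f \<in> borel_measurable N"
    and B: "\<And>x. x \<in> A \<Longrightarrow> \<bar>f x\<bar> \<le> B"
  shows "set_integrable N A (\<lambda>x. f x * w x)"
proof -
  have "integrable N (\<lambda>x. f x * (indicator A x *\<^sub>R w x))"
  proof (rule Bochner_Integration.integrable_bound)
    show "integrable N (\<lambda>x. B * (indicator A x *\<^sub>R w x))"
      using w by (simp add: set_integrable_def)
    have "(\<lambda>x. indicator A x *\<^sub>R w x) \<in> borel_measurable N"
      using w by (auto simp: set_integrable_def)
    then show "(\<lambda>x. f x * (indicator A x *\<^sub>R w x)) \<in> borel_measurable N"
      using f by (intro borel_measurable_times)
    show "AE x in N. norm (f x * (indicator A x *\<^sub>R w x)) \<le> norm (B * (indicator A x *\<^sub>R w x))"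
      using B by (auto simp: abs_mult indicator_def intro!: mult_right_mono order.trans[OF B])
  qed
  then show ?thesis
    by (simp add: set_integrable_def mult_ac)
qed

text \<open>The factor \<alpha> / \<epsilon> powr \<alpha> turns the weight into a probability
  density on [0, \<epsilon>], so averaging F - a cannot enlarge its bound e. All limits for
  \<epsilon> tending to 0 rest on this estimate.\<close>

lemma powr_average_close:
  fixes F :: "real \<Rightarrow> real"
  assumes "0 < \<alpha>" "0 < \<epsilon>" and F: "F \<in> borel_measurable borel"
    and close: "\<And>y. 0 \<le> y \<Longrightarrow> y \<le> \<epsilon> \<Longrightarrow> \<bar>F y - a\<bar> \<le> e"
  shows "\<bar>\<alpha> / \<epsilon> powr \<alpha> * (LBINT y:{0..\<epsilon>}. F y * y powr (\<alpha> - 1)) - a\<bar> \<le> e"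
proof -
  have w: "set_integrable lborel {0..\<epsilon>} (\<lambda>y. y powr (\<alpha> - 1))"
    and wi: "(LBINT y:{0..\<epsilon>}. y powr (\<alpha> - 1)) = \<epsilon> powr \<alpha> / \<alpha>"
    using powr_integrable_from_0[of "\<alpha> - 1" \<epsilon>] assms by auto
  have Fw: "set_integrable lborel {0..\<epsilon>} (\<lambda>y. (F y - a) * y powr (\<alpha> - 1))"
    by (rule set_integrable_bounded_mult[OF w]) (use F close in auto)
  have aw: "set_integrable lborel {0..\<epsilon>} (\<lambda>y. a * y powr (\<alpha> - 1))"
    using w by simp
  have "(LBINT y:{0..\<epsilon>}. F y * y powr (\<alpha> - 1))
      = (LBINT y:{0..\<epsilon>}. (F y - a) * y powr (\<alpha> - 1) + a * y powr (\<alpha> - 1))"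
    by (simp add: algebra_simps)
  also have "\<dots> = (LBINT y:{0..\<epsilon>}. (F y - a) * y powr (\<alpha> - 1)) + a * (\<epsilon> powr \<alpha> / \<alpha>)"
    using Fw aw wi by (subst set_integral_add) auto
  finally have eq: "(LBINT y:{0..\<epsilon>}. F y * y powr (\<alpha> - 1)) 
      = (LBINT y:{0..\<epsilon>}. (F y - a) * y powr (\<alpha> - 1)) + a * (\<epsilon> powr \<alpha> / \<alpha>)" .
  have "\<bar>LBINT y:{0..\<epsilon>}. (F y - a) * y powr (\<alpha> - 1)\<bar> \<le> (LBINT y:{0..\<epsilon>}. \<bar>(F y - a) * y powr (\<alpha> - 1)\<bar>)"
    using set_integral_norm_bound[OF Fw] by simp
  also have "\<dots> \<le> (LBINT y:{0..\<epsilon>}. e * y powr (\<alpha> - 1))"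
    using close w by (intro set_integral_mono set_integrable_abs Fw)
      (auto simp: abs_mult intro!: mult_right_mono)
  also have "\<dots> = e * (\<epsilon> powr \<alpha> / \<alpha>)"
    using wi by simp
  finally have b: "\<bar>LBINT y:{0..\<epsilon>}. (F y - a) * y powr (\<alpha> - 1)\<bar> \<le> e * (\<epsilon> powr \<alpha> / \<alpha>)" .
  have "\<alpha> / \<epsilon> powr \<alpha> * (LBINT y:{0..\<epsilon>}. F y * y powr (\<alpha> - 1)) - a
      = \<alpha> / \<epsilon> powr \<alpha> * (LBINT y:{0..\<epsilon>}. (F y - a) * y powr (\<alpha> - 1))"
    using assms(1,2) unfolding eq by (simp add: field_simps)
  also have "\<bar>\<dots>\<bar> \<le> \<alpha> / \<epsilon> powr \<alpha> * (e * (\<epsilon> powr \<alpha> / \<alpha>))"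
    unfolding abs_mult using b assms(1,2) by (intro mult_mono) auto
  finally show ?thesis using assms(1,2) by simp
qed

text \<open>With r = \<rho> - \<epsilon>, the factor 1 / (\<epsilon> + r) is at most 1 / \<epsilon>
  for small r and at most 1 / r for large r, which leaves powers integrable at 0 and at infinity.
  The exponent \<gamma> = \<alpha> makes the Levy measure finite; two neighbouring exponents supply
  majorants in \<open>marchaud_average_eq\<close>.\<close>

lemma shifted_kernel_integrable:
  fixes \<epsilon> \<gamma> :: real
  assumes "0 < \<gamma>" "\<gamma> < 1" "0 < \<epsilon>"
  shows "set_integrable lborel {\<epsilon>..} (\<lambda>\<rho>. (\<rho> - \<epsilon>) powr (- \<gamma>) * (1 / \<rho>))"
proof -
  have 1: "integrable lborel (\<lambda>r::real. indicator {0..1} r * r powr (- \<gamma>))"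
    using powr_integrable_from_0[of "-\<gamma>" 1] assms by (simp add: set_integrable_def)
  have 2: "integrable lborel (\<lambda>r::real. indicator {1..} r * r powr (- \<gamma> - 1))"
    using powr_integrable_to_inf[of "-\<gamma> - 1" 1] assms by (simp add: set_integrable_def)
  define w where "w r = (1 / \<epsilon>) * (indicator {0..1} r * r powr (- \<gamma>)) 
      + indicator {1..} r * r powr (- \<gamma> - 1)" for r :: real
  have w: "integrable lborel w"
    unfolding w_def using 1 2 by (intro Bochner_Integration.integrable_add integrable_mult_right)
  have "integrable lborel (\<lambda>r. indicator {\<epsilon>..} (\<epsilon> + r) *\<^sub>R (r powr (- \<gamma>) * (1 / (\<epsilon> + r))))"
  proof (rule Bochner_Integration.integrable_bound[OF w])
    show "AE r in lborel. norm (indicator {\<epsilon>..} (\<epsilon> + r) *\<^sub>R (r powr (- \<gamma>) * (1 / (\<epsilon> + r)))) \<le> norm (w r)"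
    proof (intro AE_I2)
      fix r :: real
      have w0: "0 \<le> w r" using assms by (simp add: w_def)
      show "norm (indicator {\<epsilon>..} (\<epsilon> + r) *\<^sub>R (r powr (- \<gamma>) * (1 / (\<epsilon> + r)))) \<le> norm (w r)"
      proof (cases "0 < r")
        case r: True
        show ?thesis
        proof (cases "r \<le> 1")
          case True
          have "r powr (- \<gamma>) * (1 / (\<epsilon> + r)) \<le> r powr (- \<gamma>) * (1 / \<epsilon>)"
            using r assms by (intro mult_left_mono) (auto simp: field_simps)
          also have "\<dots> \<le> w r" using True r by (simp add: w_def)
          finally show ?thesis using r assms w0 by (simp add: abs_mult)
        next
          case False
          have "r powr (- \<gamma>) * (1 / (\<epsilon> + r)) \<le> r powr (- \<gamma>) * (1 / r)"
            using r assms by (intro mult_left_mono) (auto simp: field_simps)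
          also have "\<dots> = r powr (- \<gamma> - 1)" using r by (simp add: powr_diff)
          also have "\<dots> \<le> w r" using False r by (simp add: w_def)
          finally show ?thesis using r assms w0 by (simp add: abs_mult)
        qed
      next
        case False
        then show ?thesis using w0 by (cases "r = 0") auto
      qed
    qed
  qed simp
  then have "integrable lborel (\<lambda>r. indicator {\<epsilon>..} r *\<^sub>R ((r - \<epsilon>) powr (- \<gamma>) * (1 / r)))"
    using lborel_integrable_real_affine_iff[of 1 "\<lambda>r. indicator {\<epsilon>..} r *\<^sub>R ((r - \<epsilon>) powr (- \<gamma>) * (1 / r))" \<epsilon>]
    by simp
  then show ?thesis by (simp add: set_integrable_def)
qed

section \<open>From the Marchaud derivative of an average to the shifted kernel\<close>

lemma powr_interpolate:
  fixes x a b \<beta> :: real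
  assumes "0 \<le> x" "x \<le> a" "x \<le> b" "0 \<le> \<beta>" "\<beta> \<le> 1"
  shows "x \<le> a powr \<beta> * b powr (1 - \<beta>)"
proof -
  have "x = x powr \<beta> * x powr (1 - \<beta>)"
    using assms by (simp flip: powr_add)
  also have "\<dots> \<le> a powr \<beta> * b powr (1 - \<beta>)"
    using assms by (intro mult_mono powr_mono2) auto
  finally show ?thesis .
qed

text \<open>Since y stays in a bounded interval, the scaling \<rho> = y (1 + s) does not make the
  two terms cancel: it leaves the piece between \<epsilon> and \<epsilon> (1 + s). The bound on G
  allows the two terms to be integrated separately down to 0.\<close>

lemma frullani:
  fixes G :: "real \<Rightarrow> real"
  assumes [measurable]: "G \<in> borel_measurable borel" and B: "\<And>x. 0 < x \<Longrightarrow> \<bar>G x\<bar> \<le> B"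
    and "0 < \<epsilon>" "0 < s"
  shows "(LBINT y. indicator {0<..\<epsilon>} y * ((1 + s) * G (y * (1 + s)) - G y))
       = (LBINT \<rho>. indicator {\<epsilon><..\<epsilon> * (1 + s)} \<rho> * G \<rho>)"
proof -
  have i: "integrable lborel (\<lambda>y. indicator {0<..a} y * G y)" for a
  proof (rule Bochner_Integration.integrable_bound)
    show "integrable lborel (\<lambda>y. B * indicator {0<..a} y)"
    proof (intro integrable_mult_right integrable_real_indicator)
      have "bounded {0<..a}" by (rule bounded_subset[OF bounded_closed_interval[of 0 a]]) auto
      then show "emeasure lborel {0<..a} < \<infinity>" by (rule emeasure_bounded_finite)
    qed simp
    show "AE x in lborel. norm (indicator {0<..a} x * G x) \<le> norm (B * indicator {0<..a} x)"
      using order.trans[OF B abs_ge_self] by (auto simp: indicator_def)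
  qed simp
  have sc: "(LBINT y. indicator {0<..\<epsilon>} y * ((1 + s) * G (y * (1 + s))))
          = (LBINT \<rho>. indicator {0<..\<epsilon> * (1 + s)} \<rho> * G \<rho>)"
  proof -
    have "(LBINT \<rho>. indicator {0<..\<epsilon> * (1 + s)} \<rho> * G \<rho>)
       = (1 + s) * (LBINT y. indicator {0<..\<epsilon> * (1 + s)} (0 + (1 + s) * y) * G (0 + (1 + s) * y))"
      using assms by (subst lborel_integral_real_affine[of "1 + s" _ 0]) auto
    also have "\<dots> = (LBINT y. indicator {0<..\<epsilon>} y * ((1 + s) * G (y * (1 + s))))"
      using assms unfolding integral_mult_right_zero[symmetric]
      by (intro Bochner_Integration.integral_cong refl) (auto simp: indicator_def mult_ac zero_less_mult_iff)
    finally show ?thesis by simp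
  qed
  have si: "integrable lborel (\<lambda>y. indicator {0<..\<epsilon>} y * ((1 + s) * G (y * (1 + s))))"
  proof -
    have "integrable lborel (\<lambda>y. indicator {0<..\<epsilon> * (1 + s)} (0 + (1 + s) * y) * G (0 + (1 + s) * y))"
      using lborel_integrable_real_affine[OF i[of "\<epsilon> * (1 + s)"], of "1 + s" 0] assms by simp
    then have "integrable lborel (\<lambda>y. (1 + s) * (indicator {0<..\<epsilon> * (1 + s)} (0 + (1 + s) * y) * G (0 + (1 + s) * y)))"
      by (rule integrable_mult_right)
    also have "(\<lambda>y. (1 + s) * (indicator {0<..\<epsilon> * (1 + s)} (0 + (1 + s) * y) * G (0 + (1 + s) * y)))
      = (\<lambda>y. indicator {0<..\<epsilon>} y * ((1 + s) * G (y * (1 + s))))"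
      using assms by (auto simp: indicator_def mult_ac zero_less_mult_iff fun_eq_iff)
    finally show ?thesis .
  qed
  have "(LBINT y. indicator {0<..\<epsilon>} y * ((1 + s) * G (y * (1 + s)) - G y))
      = (LBINT \<rho>. indicator {0<..\<epsilon> * (1 + s)} \<rho> * G \<rho>) - (LBINT y. indicator {0<..\<epsilon>} y * G y)"
    using si i[of \<epsilon>] unfolding right_diff_distrib sc[symmetric] by (rule Bochner_Integration.integral_diff)
  also have "\<dots> = (LBINT \<rho>. indicator {0<..\<epsilon> * (1 + s)} \<rho> * G \<rho> - indicator {0<..\<epsilon>} \<rho> * G \<rho>)"
    using i by (intro Bochner_Integration.integral_diff[symmetric])
  also have "\<dots> = (LBINT \<rho>. indicator {\<epsilon><..\<epsilon> * (1 + s)} \<rho> * G \<rho>)"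
  proof (rule Bochner_Integration.integral_cong[OF refl])
    fix \<rho>
    have "\<epsilon> \<le> \<epsilon> * (1 + s)" using assms by (simp add: field_simps)
    then have "\<rho> \<le> \<epsilon> \<Longrightarrow> \<rho> \<le> \<epsilon> * (1 + s)" by linarith
    then show "indicator {0<..\<epsilon> * (1 + s)} \<rho> * G \<rho> - indicator {0<..\<epsilon>} \<rho> * G \<rho>
        = indicator {\<epsilon><..\<epsilon> * (1 + s)} \<rho> * G \<rho>"
      using assms(3) by (auto simp: indicator_def)
  qed
  finally show ?thesis .
qed

text \<open>For fixed \<rho> the indicator says that s is at least (\<rho> - \<epsilon>) /
  \<epsilon>, so this is the tail integral of a power. It is the place where the singularity of the
  Levy kernel at \<rho> = \<epsilon> is created.\<close>

lemma integral_tail_powr: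
  fixes \<alpha> \<epsilon> \<rho> :: real
  assumes "0 < \<alpha>" "0 < \<epsilon>" "\<epsilon> < \<rho>"
  shows "(LBINT s. indicator {0<..} s * s powr (- \<alpha> - 1) * indicator {\<epsilon><..\<epsilon> * (1 + s)} \<rho>)
    = \<epsilon> powr \<alpha> / \<alpha> * (\<rho> - \<epsilon>) powr (- \<alpha>)"
proof -
  have "(LBINT s. indicator {0<..} s * s powr (- \<alpha> - 1) * indicator {\<epsilon><..\<epsilon> * (1 + s)} \<rho>)
      = (LBINT s:{(\<rho> - \<epsilon>) / \<epsilon>..}. s powr (- \<alpha> - 1))"
    unfolding set_lebesgue_integral_def
  proof (rule Bochner_Integration.integral_cong[OF refl])
    fix s :: real
    have "0 < s \<and> \<rho> \<le> \<epsilon> * (1 + s) \<longleftrightarrow> (\<rho> - \<epsilon>) / \<epsilon> \<le> s"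
    proof -
      have "\<rho> \<le> \<epsilon> * (1 + s) \<longleftrightarrow> (\<rho> - \<epsilon>) / \<epsilon> \<le> s" using assms by (simp add: field_simps)
      moreover have "0 < (\<rho> - \<epsilon>) / \<epsilon>" using assms by simp
      ultimately show ?thesis by linarith
    qed
    then show "indicator {0<..} s * s powr (- \<alpha> - 1) * indicator {\<epsilon><..\<epsilon> * (1 + s)} \<rho>
       = indicator {(\<rho> - \<epsilon>) / \<epsilon>..} s *\<^sub>R s powr (- \<alpha> - 1)"
      using assms by (auto simp: indicator_def)
  qed
  also have "\<dots> = ((\<rho> - \<epsilon>) / \<epsilon>) powr (- \<alpha>) / \<alpha>"
    using assms by (subst powr_integrable_to_inf) auto
  also have "\<dots> = \<epsilon> powr \<alpha> / \<alpha> * (\<rho> - \<epsilon>) powr (- \<alpha>)"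
    using assms by (simp add: powr_divide powr_minus field_simps)
  finally show ?thesis .
qed

lemma abs_diff_le_of_lipschitz_bounded:
  fixes f :: "real \<Rightarrow> real"
  assumes "L-lipschitz_on {0..} f" "\<And>x. 0 \<le> x \<Longrightarrow> \<bar>f x\<bar> \<le> B" "0 \<le> x" "0 \<le> y"
  shows "\<bar>f x - f y\<bar> \<le> L * \<bar>x - y\<bar>" "\<bar>f x - f y\<bar> \<le> 2 * B"
  using lipschitz_onD[OF assms(1), of x y] assms(2)[of x] assms(2)[of y] assms(3,4)
  by (auto simp: dist_real_def)

text \<open>\<open>\<Psi>\<close> averages f over [r, r + \<epsilon>], and the left side is, up to a
  constant, the right-sided Marchaud derivative of \<open>\<Psi>\<close> at 0. Because all shifts go
  forward, the bounds are asked on the half-line only; this admits decaying exponentials, which are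
  neither bounded nor Lipschitz on the whole line.\<close>

lemma marchaud_average_eq:
  fixes f :: "real \<Rightarrow> real"
  assumes \<alpha>: "0 < \<alpha>" "\<alpha> < 1" and \<epsilon>: "0 < \<epsilon>"
    and [measurable]: "f \<in> borel_measurable borel"
    and L: "L-lipschitz_on {0..} f" and B: "\<And>x. 0 \<le> x \<Longrightarrow> \<bar>f x\<bar> \<le> B"
  defines "\<Psi> \<equiv> \<lambda>r. \<alpha> / \<epsilon> powr \<alpha> * (LBINT y:{0..\<epsilon>}. f (r + y) * y powr (\<alpha> - 1))"
  shows "(LBINT r:{0<..}. (\<Psi> 0 - \<Psi> r) * r powr (- \<alpha> - 1))
       = (LBINT \<rho>:{\<epsilon>..}. (f 0 - f \<rho>) * ((\<rho> - \<epsilon>) powr (- \<alpha>) * (1 / \<rho>)))"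
proof -
  note fd = abs_diff_le_of_lipschitz_bounded[OF L B]
  have L0: "0 \<le> L" using L by (rule lipschitz_on_nonneg)
  have B0: "0 \<le> B" using B[of 0] by linarith
  define u where "u y = indicator {0..\<epsilon>} y * y powr (\<alpha> - 1)" for y :: real
  have u: "set_integrable lborel {0..\<epsilon>} (\<lambda>y. y powr (\<alpha> - 1))"
    using powr_integrable_from_0[of "\<alpha> - 1" \<epsilon>] \<alpha> \<epsilon> by auto
  then have u': "integrable lborel u" by (simp add: u_def[abs_def] set_integrable_def)
  \<comment> \<open>The weight also vanishes at y = 0, because \<open>0 powr (\<alpha> - 1)\<close>
    is 0; hence the later division by y never meets y = 0.\<close>
  have u0: "u y \<noteq> 0 \<Longrightarrow> 0 < y \<and> y \<le> \<epsilon>" "0 \<le> u y" for y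
    by (auto simp: u_def indicator_def split: if_splits)
  have [measurable]: "u \<in> borel_measurable borel" using u' by auto
  have \<Psi>: "\<Psi> r = \<alpha> / \<epsilon> powr \<alpha> * (LBINT y. f (r + y) * u y)"
    and fu: "0 \<le> r \<Longrightarrow> integrable lborel (\<lambda>y. f (r + y) * u y)" for r
  proof -
    show "\<Psi> r = \<alpha> / \<epsilon> powr \<alpha> * (LBINT y. f (r + y) * u y)"
      by (simp add: \<Psi>_def u_def set_lebesgue_integral_def mult_ac)
    assume "0 \<le> r"
    have "set_integrable lborel {0..\<epsilon>} (\<lambda>y. f (r + y) * y powr (\<alpha> - 1))"
      by (rule set_integrable_bounded_mult[OF u, where B = B]) (use B \<open>0 \<le> r\<close> in auto)
    then show "integrable lborel (\<lambda>y. f (r + y) * u y)"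
      by (simp add: set_integrable_def u_def mult_ac)
  qed

  define v where "v r = indicator {0<..} r * r powr (- \<alpha> - 1)" for r :: real
  have [measurable]: "v \<in> borel_measurable borel" by (simp add: v_def[abs_def])
  have v0: "v r \<noteq> 0 \<Longrightarrow> 0 < r" "0 \<le> v r" for r
    by (auto simp: v_def indicator_def split: if_splits)
  have near: "integrable lborel (\<lambda>r::real. indicator {0..1} r * r powr a)" if "-1 < a" for a
    using powr_integrable_from_0[of a 1] that by (simp add: set_integrable_def)
  have far: "integrable lborel (\<lambda>r::real. indicator {1..} r * r powr a)" if "a < -1" for a
    using powr_integrable_to_inf[of a 1] that by (simp add: set_integrable_def)

  have "(LBINT r:{0<..}. (\<Psi> 0 - \<Psi> r) * r powr (- \<alpha> - 1))
     = \<alpha> / \<epsilon> powr \<alpha> * (LBINT r. LBINT y. v r * ((f y - f (r + y)) * u y))"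
  proof -
    have "indicator {0<..} r *\<^sub>R ((\<Psi> 0 - \<Psi> r) * r powr (- \<alpha> - 1)) 
       = \<alpha> / \<epsilon> powr \<alpha> * (LBINT y. v r * ((f y - f (r + y)) * u y))" for r
    proof (cases "0 < r")
      case True
      have "\<Psi> 0 - \<Psi> r = \<alpha> / \<epsilon> powr \<alpha> * (LBINT y. (f y - f (r + y)) * u y)"
        using fu[of 0] fu[of r] True
        by (simp add: \<Psi> left_diff_distrib right_diff_distrib[symmetric] del: times_divide_eq_left)
      then show ?thesis
        using True unfolding integral_mult_right_zero by (simp add: v_def mult_ac)
    qed (simp add: v_def)
    then show ?thesis by (simp add: set_lebesgue_integral_def)
  qed
  also have "(LBINT r. LBINT y. v r * ((f y - f (r + y)) * u y))
     = (LBINT y. LBINT r. v r * ((f y - f (r + y)) * u y))"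
  proof (rule swap_integrals)
    \<comment> \<open>The difference is at most L r, used for r up to 1, and at most 2 B, used
      beyond. Both bounds are uniform in y, so the other factor of the majorant can be the weight u
      itself.\<close>
    let ?w = "\<lambda>r. L * (indicator {0..1} r * r powr (- \<alpha>)) 
      + 2 * B * (indicator {1..} r * r powr (- \<alpha> - 1)) :: real"
    show "integrable lborel ?w"
      using \<alpha> by (intro Bochner_Integration.integrable_add integrable_mult_right near far) auto
    fix r y :: real
    show "\<bar>v r * ((f y - f (r + y)) * u y)\<bar> \<le> ?w r * \<bar>u y\<bar>"
    proof (cases "0 < r \<and> 0 \<le> y")
      case True
      have "r powr (- \<alpha> - 1) * \<bar>f y - f (r + y)\<bar> \<le> ?w r"
      proof (cases "r \<le> 1")
        case r: True
        have "r powr (- \<alpha> - 1) * \<bar>f y - f (r + y)\<bar> \<le> r powr (- \<alpha> - 1) * (L * r)"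
          using fd(1)[of y "r + y"] True by (intro mult_left_mono) auto
        also have "\<dots> = L * r powr (- \<alpha>)" using True by (simp add: powr_diff)
        also have "\<dots> \<le> ?w r" using True r B0 by simp
        finally show ?thesis .
      next
        case r: False
        have "r powr (- \<alpha> - 1) * \<bar>f y - f (r + y)\<bar> \<le> r powr (- \<alpha> - 1) * (2 * B)"
          using fd(2)[of y "r + y"] True by (intro mult_left_mono) auto
        also have "\<dots> \<le> ?w r" using True r by (simp add: mult_ac)
        finally show ?thesis .
      qed
      then have "r powr (- \<alpha> - 1) * \<bar>f y - f (r + y)\<bar> * \<bar>u y\<bar> \<le> ?w r * \<bar>u y\<bar>"
        by (rule mult_right_mono) simp
      then show ?thesis using True by (simp add: v_def abs_mult mult.assoc)
    next
      case False
      then have z: "v r = 0 \<or> u y = 0" using v0(1)[of r] u0(1)[of y] by force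
      have "0 \<le> ?w r" using L0 B0 by simp
      then have "0 \<le> ?w r * \<bar>u y\<bar>" by (intro mult_nonneg_nonneg) auto
      then show ?thesis using z by auto
    qed
  qed (use u' in auto)
  also have "\<dots> = (LBINT y. LBINT s. indicator {0<..\<epsilon>} y * (v s * (f y - f (y * (1 + s))) / y))"
  proof (rule Bochner_Integration.integral_cong[OF refl])
    fix y :: real
    show "(LBINT r. v r * ((f y - f (r + y)) * u y))
        = (LBINT s. indicator {0<..\<epsilon>} y * (v s * (f y - f (y * (1 + s))) / y))"
    proof (cases "0 < y \<and> y \<le> \<epsilon>")
      case True
      have "(LBINT r. v r * ((f y - f (r + y)) * u y))
          = y * (LBINT s. v (0 + y * s) * ((f y - f (0 + y * s + y)) * u y))"
        using True by (subst lborel_integral_real_affine[of y _ 0]) auto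
      also have "\<dots> = (LBINT s. y * (v (0 + y * s) * ((f y - f (0 + y * s + y)) * u y)))"
        by simp
      also have "\<dots> = (LBINT s. indicator {0<..\<epsilon>} y * (v s * (f y - f (y * (1 + s))) / y))"
      proof (rule Bochner_Integration.integral_cong[OF refl])
        fix s
        have "y * (v (y * s) * u y) = v s / y"
        proof (cases "0 < s")
          case s: True
          have "y * (y powr (- \<alpha> - 1) * y powr (\<alpha> - 1)) = 1 / y"
            using True by (simp add: powr_diff powr_minus field_simps)
          then have "s powr (- \<alpha> - 1) * (y * (y powr (- \<alpha> - 1) * y powr (\<alpha> - 1))) = s powr (- \<alpha> - 1) * (1 / y)"
            by simp
          then show ?thesis
            using s True by (simp add: v_def u_def powr_mult zero_less_mult_iff mult_ac)
        next
          case False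
          then show ?thesis using True by (auto simp: v_def zero_less_mult_iff)
        qed
        then have "y * (v (y * s) * u y) * (f y - f (y * (1 + s))) = v s / y * (f y - f (y * (1 + s)))"
          by simp
        moreover have "0 + y * s + y = y * (1 + s)" by (simp add: algebra_simps)
        ultimately show "y * (v (0 + y * s) * ((f y - f (0 + y * s + y)) * u y)) 
          = indicator {0<..\<epsilon>} y * (v s * (f y - f (y * (1 + s))) / y)"
          using True by (simp add: mult_ac)
      qed
      finally show ?thesis .
    next
      case False
      then have "u y = 0" using u0(1)[of y] by blast
      then show ?thesis using False by auto
    qed
  qed
  also have "\<dots> = (LBINT s. LBINT y. indicator {0<..\<epsilon>} y * (v s * (f y - f (y * (1 + s))) / y))"
  proof (rule swap_integrals[symmetric, where F = "\<lambda>s y. indicator {0<..\<epsilon>} y * (v s * (f y - f (y * (1 + s))) / y)"])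
    \<comment> \<open>Interpolating between the Lipschitz bound \<open>L s\<close> and the sup bound \<open>2 B / y\<close> with a small
      exponent \<open>\<beta>\<close> gives integrability in \<open>y\<close> near \<open>0\<close> and in \<open>s\<close> near infinity at once.\<close>
    define \<beta> where "\<beta> = \<alpha> / 2"
    have \<beta>: "0 < \<beta>" "\<beta> < \<alpha>" "\<beta> < 1" using \<alpha> by (auto simp: \<beta>_def)
    let ?K = "L powr \<beta> * (2 * B) powr (1 - \<beta>)"
    let ?w = "\<lambda>s. L * (indicator {0..1} s * s powr (- \<alpha>)) 
      + ?K * (indicator {1..} s * s powr (\<beta> - \<alpha> - 1)) :: real"
    \<comment> \<open>The two summands serve the two ranges of s: for s up to 1 the Lipschitz bound
      does not involve y, and \<open>y powr 0\<close> is just 1 for positive y; for larger s the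
      interpolated bound brings in the negative power of y.\<close>
    let ?p = "\<lambda>y. indicator {0..\<epsilon>} y * y powr 0 + indicator {0..\<epsilon>} y * y powr (\<beta> - 1) :: real"
    show "integrable lborel ?w"
      using \<alpha> \<beta> by (intro Bochner_Integration.integrable_add integrable_mult_right near far) auto
    show "integrable lborel ?p"
      using powr_integrable_from_0(1)[of 0 \<epsilon>] powr_integrable_from_0(1)[of "\<beta> - 1" \<epsilon>] \<epsilon> \<beta>
      by (intro Bochner_Integration.integrable_add) (auto simp: set_integrable_def)
    fix s y :: real
    have w0: "0 \<le> ?w s" and p0: "0 \<le> ?p y" using L0 by auto
    show "\<bar>indicator {0<..\<epsilon>} y * (v s * (f y - f (y * (1 + s))) / y)\<bar> \<le> ?w s * \<bar>?p y\<bar>"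
    proof (cases "0 < s \<and> 0 < y \<and> y \<le> \<epsilon>")
      case True
      then have sy: "0 < s" "0 < y" "y \<le> \<epsilon>" by auto
      define X where "X = \<bar>f y - f (y * (1 + s))\<bar> / y"
      have X0: "0 \<le> X" using sy by (simp add: X_def)
      have "\<bar>y - y * (1 + s)\<bar> = y * s" using sy by (simp add: algebra_simps)
      then have X1: "X \<le> L * s"
        using fd(1)[of y "y * (1 + s)"] sy by (simp add: X_def field_simps)
      have X2: "X \<le> 2 * B / y"
        using fd(2)[of y "y * (1 + s)"] sy by (simp add: X_def field_simps)
      have p1: "1 \<le> ?p y" "y powr (\<beta> - 1) \<le> ?p y" using sy by auto
      have "s powr (- \<alpha> - 1) * X \<le> ?w s * ?p y"
      proof (cases "s \<le> 1")
        case s: True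
        have "s powr (- \<alpha> - 1) * X \<le> s powr (- \<alpha> - 1) * (L * s)"
          by (intro mult_left_mono X1) auto
        also have "\<dots> = L * s powr (- \<alpha>)" using sy by (simp add: powr_diff)
        also have "\<dots> \<le> ?w s" using sy s by simp
        also have "\<dots> \<le> ?w s * ?p y" using mult_left_mono[OF p1(1) w0] by simp
        finally show ?thesis .
      next
        case s: False
        have "X \<le> (L * s) powr \<beta> * (2 * B / y) powr (1 - \<beta>)"
          using X0 X1 X2 \<beta> by (intro powr_interpolate) auto
        also have "\<dots> = ?K * (s powr \<beta> * y powr (\<beta> - 1))"
        proof -
          have "(2 * B / y) powr (1 - \<beta>) = (2 * B) powr (1 - \<beta>) * y powr (\<beta> - 1)"
            using sy B0 powr_minus_divide[of y "1 - \<beta>"] by (simp add: powr_divide)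
          then show ?thesis using L0 sy by (simp add: powr_mult mult_ac)
        qed
        finally have "s powr (- \<alpha> - 1) * X \<le> s powr (- \<alpha> - 1) * (?K * (s powr \<beta> * y powr (\<beta> - 1)))"
          by (intro mult_left_mono) auto
        also have "\<dots> = ?K * (s powr (- \<alpha> - 1) * s powr \<beta>) * y powr (\<beta> - 1)" by (simp add: mult_ac)
        also have "s powr (- \<alpha> - 1) * s powr \<beta> = s powr (\<beta> - \<alpha> - 1)"
          by (simp add: powr_add[symmetric] algebra_simps)
        also have "?K * s powr (\<beta> - \<alpha> - 1) * y powr (\<beta> - 1) \<le> ?w s * ?p y"
          using s p1(2) w0 by (intro mult_mono) auto
        finally show ?thesis .
      qed
      then show ?thesis using sy p0 by (simp add: v_def X_def abs_mult abs_divide)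
    next
      case False
      then have "v s = 0 \<or> indicator {0<..\<epsilon>} y = (0::real)" using v0(1)[of s] by force
      then show ?thesis using mult_nonneg_nonneg[OF w0 abs_ge_zero[of "?p y"]] by auto
    qed
  qed simp
  also have "\<dots> = (LBINT s. LBINT \<rho>. v s * (indicator {\<epsilon><..\<epsilon> * (1 + s)} \<rho> * ((f 0 - f \<rho>) / \<rho>)))"
  proof (rule Bochner_Integration.integral_cong[OF refl])
    fix s :: real
    show "(LBINT y. indicator {0<..\<epsilon>} y * (v s * (f y - f (y * (1 + s))) / y))
      = (LBINT \<rho>. v s * (indicator {\<epsilon><..\<epsilon> * (1 + s)} \<rho> * ((f 0 - f \<rho>) / \<rho>)))"
    proof (cases "0 < s")
      case True
      \<comment> \<open>The value f 0 drops out of the difference of f at y and y (1 + s). Inserting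
        it makes G bounded by L near 0, as \<open>frullani\<close> requires.\<close>
      let ?G = "\<lambda>\<rho>. (f 0 - f \<rho>) / \<rho>"
      have GL: "\<bar>?G x\<bar> \<le> L" if "0 < x" for x
        using fd(1)[of 0 x] that by (simp add: abs_divide field_simps)
      have "(LBINT y. indicator {0<..\<epsilon>} y * (v s * (f y - f (y * (1 + s))) / y))
         = (LBINT y. v s * (indicator {0<..\<epsilon>} y * ((1 + s) * ?G (y * (1 + s)) - ?G y)))"
      proof (rule Bochner_Integration.integral_cong[OF refl])
        fix y :: real
        have "(1 + s) * ?G (y * (1 + s)) = (f 0 - f (y * (1 + s))) / y"
          using True by simp
        then have "(1 + s) * ?G (y * (1 + s)) - ?G y = (f y - f (y * (1 + s))) / y"
          by (simp add: diff_divide_distrib)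
        then show "indicator {0<..\<epsilon>} y * (v s * (f y - f (y * (1 + s))) / y)
          = v s * (indicator {0<..\<epsilon>} y * ((1 + s) * ?G (y * (1 + s)) - ?G y))"
          by simp
      qed
      also have "\<dots> = v s * (LBINT \<rho>. indicator {\<epsilon><..\<epsilon> * (1 + s)} \<rho> * ?G \<rho>)"
        using frullani[of ?G L \<epsilon> s] GL \<epsilon> True by simp
      finally show ?thesis unfolding integral_mult_right_zero .
    qed (simp add: v_def)
  qed
  also have "\<dots> = (LBINT \<rho>. LBINT s. v s * (indicator {\<epsilon><..\<epsilon> * (1 + s)} \<rho> * ((f 0 - f \<rho>) / \<rho>)))"
  proof (rule swap_integrals)
    \<comment> \<open>On the domain \<open>1 \<le> (\<epsilon> s / (\<rho> - \<epsilon>)) powr \<gamma>\<close>; take \<open>\<gamma> = a > \<alpha>\<close> for small \<open>s\<close> and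
      \<open>\<gamma> = b < \<alpha>\<close> for large \<open>s\<close>.\<close>
    define a where "a = (1 + \<alpha>) / 2"
    define b where "b = \<alpha> / 2"
    have ab: "0 < a" "\<alpha> < a" "a < 1" "0 < b" "b < \<alpha>" "b < 1" using \<alpha> by (auto simp: a_def b_def)
    let ?w = "\<lambda>s. \<epsilon> powr a * (indicator {0..1} s * s powr (a - \<alpha> - 1)) 
      + \<epsilon> powr b * (indicator {1..} s * s powr (b - \<alpha> - 1)) :: real"
    let ?k = "\<lambda>\<gamma> \<rho>. indicator {\<epsilon>..} \<rho> *\<^sub>R ((\<rho> - \<epsilon>) powr (- \<gamma>) * (1 / \<rho>)) :: real"
    let ?p = "\<lambda>\<rho>. 2 * B * (?k a \<rho> + ?k b \<rho>) :: real"
    show "integrable lborel ?w"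
      using \<alpha> ab by (intro Bochner_Integration.integrable_add integrable_mult_right near far) auto
    show "integrable lborel ?p"
      using shifted_kernel_integrable[of a \<epsilon>] shifted_kernel_integrable[of b \<epsilon>] ab \<epsilon>
      by (intro Bochner_Integration.integrable_add integrable_mult_right) (auto simp: set_integrable_def)
    have "Measurable.pred (borel \<Otimes>\<^sub>M borel) (\<lambda>x::real\<times>real. snd x \<in> {\<epsilon><..\<epsilon> * (1 + fst x)})"
      by simp
    then show "(\<lambda>(s, \<rho>). v s * (indicator {\<epsilon><..\<epsilon> * (1 + s)} \<rho> * ((f 0 - f \<rho>) / \<rho>)))
        \<in> borel_measurable (borel \<Otimes>\<^sub>M borel)"
      unfolding case_prod_beta by measurable
    fix s \<rho> :: real
    have k0: "0 \<le> ?k \<gamma> \<rho>" for \<gamma> using \<epsilon> by (auto simp: indicator_def)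
    have w0: "0 \<le> ?w s" by auto
    have q0: "0 \<le> 2 * B * ?k \<gamma> \<rho>" for \<gamma> using k0[of \<gamma>] B0 by (intro mult_nonneg_nonneg) auto
    have p0: "0 \<le> ?p \<rho>" using k0 B0 by (intro mult_nonneg_nonneg add_nonneg_nonneg) auto
    show "\<bar>v s * (indicator {\<epsilon><..\<epsilon> * (1 + s)} \<rho> * ((f 0 - f \<rho>) / \<rho>))\<bar> \<le> ?w s * \<bar>?p \<rho>\<bar>"
    proof (cases "0 < s \<and> \<epsilon> < \<rho> \<and> \<rho> \<le> \<epsilon> * (1 + s)")
      case True
      then have s: "0 < s" "\<epsilon> < \<rho>" "\<rho> - \<epsilon> \<le> \<epsilon> * s" by (auto simp: algebra_simps)
      have one: "1 \<le> \<epsilon> powr \<gamma> * s powr \<gamma> * (\<rho> - \<epsilon>) powr (- \<gamma>)" if "0 < \<gamma>" for \<gamma>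
      proof -
        have "1 = (\<rho> - \<epsilon>) powr \<gamma> * (\<rho> - \<epsilon>) powr (- \<gamma>)"
          using s by (simp flip: powr_add)
        also have "\<dots> \<le> (\<epsilon> * s) powr \<gamma> * (\<rho> - \<epsilon>) powr (- \<gamma>)"
          using s that by (intro mult_right_mono powr_mono2) auto
        finally show ?thesis using s \<epsilon> by (simp add: powr_mult)
      qed
      have st: "s powr (- \<alpha> - 1) * (2 * B / \<rho>) \<le> \<epsilon> powr \<gamma> * s powr (\<gamma> - \<alpha> - 1) * (2 * B * ?k \<gamma> \<rho>)"
        if "0 < \<gamma>" for \<gamma>
      proof -
        have "s powr (- \<alpha> - 1) * (2 * B / \<rho>) * 1 
          \<le> s powr (- \<alpha> - 1) * (2 * B / \<rho>) * (\<epsilon> powr \<gamma> * s powr \<gamma> * (\<rho> - \<epsilon>) powr (- \<gamma>))"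
          using s B0 \<epsilon> by (intro mult_left_mono one that) auto
        also have "\<dots> = \<epsilon> powr \<gamma> * (s powr (- \<alpha> - 1) * s powr \<gamma>) * (2 * B * ?k \<gamma> \<rho>)"
          using s by simp
        also have "s powr (- \<alpha> - 1) * s powr \<gamma> = s powr (\<gamma> - \<alpha> - 1)"
          by (simp add: powr_add[symmetric] algebra_simps)
        finally show ?thesis by simp
      qed
      have "s powr (- \<alpha> - 1) * (\<bar>f 0 - f \<rho>\<bar> / \<rho>) \<le> s powr (- \<alpha> - 1) * (2 * B / \<rho>)"
        using fd(2)[of 0 \<rho>] s \<epsilon> by (intro mult_left_mono divide_right_mono) auto
      also have "\<dots> \<le> ?w s * ?p \<rho>"
      proof (cases "s \<le> 1")
        case True
        have "\<epsilon> powr a * s powr (a - \<alpha> - 1) * (2 * B * ?k a \<rho>) \<le> ?w s * ?p \<rho>"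
          using True s(1) B0 k0 w0 by (intro mult_mono mult_left_mono q0) auto
        then show ?thesis using st[OF ab(1)] by linarith
      next
        case False
        have "\<epsilon> powr b * s powr (b - \<alpha> - 1) * (2 * B * ?k b \<rho>) \<le> ?w s * ?p \<rho>"
          using False s(1) B0 k0 w0 by (intro mult_mono mult_left_mono q0) auto
        then show ?thesis using st[OF ab(4)] by linarith
      qed
      finally show ?thesis using True \<epsilon> unfolding abs_of_nonneg[OF p0] by (simp add: v_def abs_mult abs_divide)
    next
      case False
      then have "v s = 0 \<or> indicator {\<epsilon><..\<epsilon> * (1 + s)} \<rho> = (0::real)" using v0(1)[of s] by force
      then show ?thesis using mult_nonneg_nonneg[OF w0 abs_ge_zero[of "?p \<rho>"]] by auto
    qed
  qed
  also have "\<dots> = (LBINT \<rho>. \<epsilon> powr \<alpha> / \<alpha> * (indicator {\<epsilon>..} \<rho> *\<^sub>R ((f 0 - f \<rho>) * ((\<rho> - \<epsilon>) powr (- \<alpha>) * (1 / \<rho>)))))"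
  proof (rule Bochner_Integration.integral_cong[OF refl])
    fix \<rho> :: real
    show "(LBINT s. v s * (indicator {\<epsilon><..\<epsilon> * (1 + s)} \<rho> * ((f 0 - f \<rho>) / \<rho>)))
      = \<epsilon> powr \<alpha> / \<alpha> * (indicator {\<epsilon>..} \<rho> *\<^sub>R ((f 0 - f \<rho>) * ((\<rho> - \<epsilon>) powr (- \<alpha>) * (1 / \<rho>))))"
    proof (cases "\<epsilon> < \<rho>")
      case True
      have "(LBINT s. v s * (indicator {\<epsilon><..\<epsilon> * (1 + s)} \<rho> * ((f 0 - f \<rho>) / \<rho>)))
        = (LBINT s. indicator {0<..} s * s powr (- \<alpha> - 1) * indicator {\<epsilon><..\<epsilon> * (1 + s)} \<rho> * ((f 0 - f \<rho>) / \<rho>))"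
        by (simp add: v_def mult_ac)
      also have "\<dots> = (LBINT s. indicator {0<..} s * s powr (- \<alpha> - 1) * indicator {\<epsilon><..\<epsilon> * (1 + s)} \<rho>) * ((f 0 - f \<rho>) / \<rho>)"
        by (rule integral_mult_left_zero)
      finally show ?thesis
        unfolding integral_tail_powr[OF \<alpha>(1) \<epsilon> True] using True by simp
    next
      case False
      \<comment> \<open>At \<rho> = \<epsilon> the right side is 0 as well, because
        \<open>0 powr (- \<alpha>)\<close> is 0.\<close>
      then show ?thesis by (cases "\<rho> = \<epsilon>") auto
    qed
  qed
  also have "\<dots> = \<epsilon> powr \<alpha> / \<alpha> * (LBINT \<rho>:{\<epsilon>..}. (f 0 - f \<rho>) * ((\<rho> - \<epsilon>) powr (- \<alpha>) * (1 / \<rho>)))"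
    unfolding set_lebesgue_integral_def by (rule integral_mult_right_zero)
  finally show ?thesis using \<alpha> \<epsilon> by simp
qed

section \<open>Forward equation for compound Poisson processes on the orthant\<close>

text \<open>The span of the exponentials whose evolution the Laplace transform gives. Closing under
  binary sums instead of writing finite sums over index sets reduces each property to one
  exponential and one addition. Members are functions on all of space, but they are controlled only
  on the orthant.\<close>

inductive expsum :: "(real ^ 'd \<Rightarrow> real) \<Rightarrow> bool" where
  exp: "nonneg_vec \<eta> \<Longrightarrow> expsum (\<lambda>x. a * exp (- (\<eta> \<bullet> x)))"
| add: "expsum p \<Longrightarrow> expsum q \<Longrightarrow> expsum (\<lambda>x. p x + q x)"

lemma nonneg_vec_inner: "nonneg_vec \<eta> \<Longrightarrow> nonneg_vec x \<Longrightarrow> 0 \<le> \<eta> \<bullet> x"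
  by (simp add: nonneg_vec_def inner_vec_def sum_nonneg)

lemma nonneg_vec_add: "nonneg_vec x \<Longrightarrow> nonneg_vec y \<Longrightarrow> nonneg_vec (x + y)"
  by (simp add: nonneg_vec_def)

lemma nonneg_vec_pred [measurable]: "Measurable.pred borel (nonneg_vec :: real ^ 'd \<Rightarrow> bool)"
proof -
  have "closed {x :: real ^ 'd. \<forall>i. 0 \<le> x $ i}"
    by (intro closed_Collect_all closed_Collect_le continuous_intros)
  then show ?thesis
    unfolding nonneg_vec_def[abs_def] by (simp add: pred_def)
qed

lemma expsum_const: "expsum (\<lambda>x. a)"
  using expsum.exp[of 0 a] by (simp add: nonneg_vec_def)

lemma expsum_sum: "finite I \<Longrightarrow> (\<And>i. i \<in> I \<Longrightarrow> expsum (p i)) \<Longrightarrow> expsum (\<lambda>x. \<Sum>i\<in>I. p i x)"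
  by (induction I rule: finite_induct) (auto intro: expsum_const expsum.add)

text \<open>Exponents add and the orthant is closed under addition, so the span is an algebra. This
  is what lets polynomials in the variables exp (- x_i) stay inside it.\<close>

lemma expsum_mult:
  assumes "expsum p" "expsum q"
  shows "expsum (\<lambda>x. p x * q x)"
  using assms
proof (induction arbitrary: q rule: expsum.induct)
  case (exp \<eta> a)
  from exp(2,1) show ?case
  proof (induction rule: expsum.induct)
    case (exp \<zeta> b)
    have "expsum (\<lambda>x. (a * b) * exp (- ((\<eta> + \<zeta>) \<bullet> x)))"
      using exp by (intro expsum.exp nonneg_vec_add)
    moreover have "exp (- ((\<eta> + \<zeta>) \<bullet> x)) = exp (- (\<eta> \<bullet> x)) * exp (- (\<zeta> \<bullet> x))" for x
      by (simp add: inner_add_left flip: exp_add)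
    ultimately show ?case by (simp add: mult_ac)
  next
    case (add p q)
    then show ?case using expsum.add by (force simp: distrib_left)
  qed
next
  case (add p p')
  then show ?case using expsum.add by (force simp: distrib_right)
qed

lemma expsum_measurable [measurable_dest]: "expsum p \<Longrightarrow> p \<in> borel_measurable borel"
  by (induction rule: expsum.induct) auto

lemma expsum_bounded: "expsum p \<Longrightarrow> \<exists>B. \<forall>x. nonneg_vec x \<longrightarrow> \<bar>p x\<bar> \<le> B"
proof (induction rule: expsum.induct)
  case (exp \<eta> a)
  show ?case
    using exp by (intro exI[of _ "\<bar>a\<bar>"]) (auto simp: abs_mult mult_left_le nonneg_vec_inner)
next
  case (add p q)
  then obtain A B where "\<And>x. nonneg_vec x \<Longrightarrow> \<bar>p x\<bar> \<le> A" "\<And>x. nonneg_vec x \<Longrightarrow> \<bar>q x\<bar> \<le> B" by blast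
  then show ?case
    by (intro exI[of _ "A + B"]) (auto intro: order.trans[OF abs_triangle_ineq] add_mono)
qed

text \<open>The variables exp (- x_i) are exponentials with unit vectors as exponents, and constants
  are exponentials with exponent 0; expanding a linear form in the standard basis and closure under
  products do the rest.\<close>

lemma expsum_real_polynomial:
  fixes q :: "real ^ 'd \<Rightarrow> real"
  assumes "real_polynomial_function q"
  shows "expsum (\<lambda>x. q (\<chi> i. exp (- (x $ i))))"
  using assms
proof (induction rule: real_polynomial_function.induct)
  case (linear f)
  have "f (\<chi> i. exp (- (x $ i))) = (\<Sum>i\<in>UNIV. f (axis i 1) * exp (- (axis i 1 \<bullet> x)))" for x
  proof -
    have "(\<chi> i. exp (- (x $ i))) = (\<Sum>i\<in>UNIV. exp (- (x $ i)) *\<^sub>R axis i (1::real))"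
      using basis_expansion[of "\<chi> i. exp (- (x $ i))"] by (simp add: scalar_mult_eq_scaleR)
    then show ?thesis
      by (simp add: linear_sum[OF bounded_linear.linear[OF linear]]
          linear_cmul[OF bounded_linear.linear[OF linear]] inner_axis' mult_ac)
  qed
  then show ?case
    by (simp, intro expsum_sum expsum.exp) (auto simp: nonneg_vec_def axis_def)
next
  case (mult f g)
  then show ?case by (intro expsum_mult)
qed (auto intro: expsum_const expsum.add)

text \<open>In the variable u = exp (- x) the faces u_i = 0 of the cube correspond to infinity,
  where \<phi> need not have a limit. Replacing u_i by its maximum with exp (- n) yields a function
  \<open>g n\<close> that is continuous on the closed cube. At a fixed x the truncation is inactive
  once n exceeds every coordinate, which gives convergence at each point and not uniformly. The
  extra 1 in the bound absorbs the approximation error 1 / (n + 1).\<close>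

lemma expsum_approx:
  fixes \<phi> :: "real ^ 'd \<Rightarrow> real"
  assumes cont: "continuous_on UNIV \<phi>" and B: "\<And>x. \<bar>\<phi> x\<bar> \<le> B"
  obtains p where "\<And>n::nat. expsum (p n)" "\<And>n x. nonneg_vec x \<Longrightarrow> \<bar>p n x\<bar> \<le> B + 1"
    "\<And>x. nonneg_vec x \<Longrightarrow> (\<lambda>n. p n x) \<longlonglongrightarrow> \<phi> x"
proof -
  define g where "g n u = \<phi> (\<chi> i. - ln (max (u $ i) (exp (- real n))))" for n and u :: "real ^ 'd"
  have pos: "0 < max a (exp (- real n))" for a n by (simp add: less_max_iff_disj)
  have "continuous_on UNIV (g n)" for n
    unfolding g_def
    by (intro continuous_on_compose2[OF cont] continuous_intros subset_UNIV)
       (metis pos less_irrefl)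
  then have "continuous_on (cbox 0 1) (g n)" for n
    by (rule continuous_on_subset) auto
  then have "\<exists>q. real_polynomial_function q \<and> (\<forall>u\<in>cbox 0 1. \<bar>g n u - q u\<bar> < 1 / (real n + 1))" for n
    using Stone_Weierstrass_real_polynomial_function[OF compact_cbox, of 0 1 "g n" "1 / (real n + 1)"]
    by (metis add_nonneg_pos of_nat_0_le_iff zero_less_divide_1_iff zero_less_one)
  then obtain q where q: "\<And>n. real_polynomial_function (q n)"
    and qg: "\<And>n u. u \<in> cbox 0 1 \<Longrightarrow> \<bar>g n u - q n u\<bar> < 1 / (real n + 1)" by metis
  let ?E = "\<lambda>x :: real ^ 'd. \<chi> i. exp (- (x $ i))"
  have E: "?E x \<in> cbox 0 1" if "nonneg_vec x" for x
    using that by (auto simp: mem_box_cart nonneg_vec_def)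
  have close: "\<bar>g n (?E x) - q n (?E x)\<bar> < 1 / (real n + 1)" if "nonneg_vec x" for n x
    using qg E that by blast
  show thesis
  proof
    show "expsum (\<lambda>x. q n (?E x))" for n by (intro expsum_real_polynomial q)
    show "\<bar>q n (?E x)\<bar> \<le> B + 1" if "nonneg_vec x" for n x
    proof -
      have "1 / (real n + 1) \<le> 1" by simp
      moreover have "\<bar>g n (?E x)\<bar> \<le> B" unfolding g_def by (rule B)
      ultimately show ?thesis using close[OF that, of n] by linarith
    qed
    fix x :: "real ^ 'd" assume x: "nonneg_vec x"
    obtain m :: nat where m: "\<And>i. x $ i \<le> real m"
    proof -
      have "\<bar>x $ i\<bar> \<le> real (nat \<lceil>norm x\<rceil>)" for i
        using component_le_norm_cart[of x i] by linarith
      then show ?thesis using that by (meson abs_le_D1)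
    qed
    have "g n (?E x) = \<phi> x" if "m \<le> n" for n
    proof -
      have "x $ i \<le> real n" for i using m[of i] that by linarith
      then have "max (exp (- (x $ i))) (exp (- real n)) = exp (- (x $ i))" for i
        by (simp add: max_def order.antisym)
      then show ?thesis by (simp add: g_def)
    qed
    then have "\<forall>\<^sub>F n in sequentially. norm (q n (?E x) - \<phi> x) \<le> 1 / (real n + 1)"
      using close[OF x] by (intro eventually_sequentiallyI[of m]) (metis abs_minus_commute less_imp_le real_norm_def)
    moreover have "(\<lambda>n. 1 / (real n + 1)) \<longlonglongrightarrow> 0"
      using LIMSEQ_inverse_real_of_nat by (simp add: field_simps)
    ultimately have "(\<lambda>n. q n (?E x) - \<phi> x) \<longlonglongrightarrow> 0" by (rule Lim_null_comparison)
    then show "(\<lambda>n. q n (?E x)) \<longlonglongrightarrow> \<phi> x" by (simp add: LIM_zero_iff)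
  qed
qed

section \<open>Second-order bounds in time and the forward equation\<close>

lemma second_order_bound:
  fixes f f' f'' :: "real \<Rightarrow> real"
  assumes f: "\<And>u. 0 < u \<Longrightarrow> (f has_real_derivative f' u) (at u)"
    and f': "\<And>u. 0 < u \<Longrightarrow> (f' has_real_derivative f'' u) (at u)"
    and K: "\<And>u. 0 < u \<Longrightarrow> \<bar>f'' u\<bar> \<le> K" and "0 < s" "0 < t"
  shows "\<bar>f t - f s - (t - s) * f' s\<bar> \<le> K * (t - s)\<^sup>2"
proof -
  \<comment> \<open>An unordered segment treats t before s and t after s together, as a two-sided
    derivative at s demands.\<close>
  let ?S = "closed_segment s t"
  have S: "0 < u" if "u \<in> ?S" for u
    using that assms(4,5) by (auto simp: closed_segment_eq_real_ivl split: if_splits)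
  have K0: "0 \<le> K" using K[OF \<open>0 < s\<close>] by linarith
  have f'_le: "\<bar>f' u - f' s\<bar> \<le> K * \<bar>t - s\<bar>" if u: "u \<in> ?S" for u
  proof -
    have "norm (f' u - f' s) \<le> K * norm (u - s)"
    proof (rule field_differentiable_bound[of ?S f' f''])
      show "(f' has_field_derivative f'' z) (at z within ?S)" if "z \<in> ?S" for z
        using f'[OF S[OF that]] by (rule has_field_derivative_at_within)
      show "norm (f'' z) \<le> K" if "z \<in> ?S" for z using K[OF S[OF that]] by simp
    qed (use u in auto)
    also have "\<dots> \<le> K * \<bar>t - s\<bar>"
      using u K0 by (intro mult_left_mono) (auto simp: closed_segment_eq_real_ivl split: if_splits)
    finally show ?thesis by simp
  qed
  \<comment> \<open>A second use of the mean value inequality, now for f minus its tangent slope,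
    whose derivative was just bounded on the segment. The factor 1/2 of the Taylor remainder is
    given up.\<close>
  have "norm ((f t - t * f' s) - (f s - s * f' s)) \<le> K * \<bar>t - s\<bar> * norm (t - s)"
  proof (rule field_differentiable_bound[of ?S "\<lambda>u. f u - u * f' s" "\<lambda>u. f' u - f' s"])
    show "((\<lambda>u. f u - u * f' s) has_field_derivative f' z - f' s) (at z within ?S)" if "z \<in> ?S" for z
      using has_field_derivative_at_within[OF f[OF S[OF that]]]
      by (auto intro!: derivative_eq_intros)
    show "norm (f' z - f' s) \<le> K * \<bar>t - s\<bar>" if "z \<in> ?S" for z using f'_le[OF that] by simp
  qed auto
  then show ?thesis by (simp add: algebra_simps power2_eq_square)
qed

lemma has_real_derivative_of_second_order_bound:
  fixes f :: "real \<Rightarrow> real"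
  assumes "0 < s" and *: "\<And>t. 0 < t \<Longrightarrow> \<bar>f t - f s - (t - s) * D\<bar> \<le> K * (t - s)\<^sup>2"
  shows "(f has_real_derivative D) (at s)"
proof -
  have "\<forall>\<^sub>F t in at s. t \<in> {0<..}"
    using eventually_at_in_open'[of "{0<..}" s] assms(1) by auto
  moreover have "\<forall>\<^sub>F t in at s. t \<noteq> s" by (simp add: eventually_at_filter)
  ultimately have "\<forall>\<^sub>F t in at s. norm ((f t - f s) / (t - s) - D) \<le> K * \<bar>t - s\<bar>"
  proof eventually_elim
    case (elim t)
    then have "\<bar>(f t - f s - (t - s) * D) / (t - s)\<bar> \<le> K * (t - s)\<^sup>2 / \<bar>t - s\<bar>"
      unfolding abs_divide using * by (intro divide_right_mono) auto
    moreover have "(f t - f s - (t - s) * D) / (t - s) = (f t - f s) / (t - s) - D"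
      using elim by (simp add: diff_divide_distrib)
    moreover have "(t - s)\<^sup>2 = \<bar>t - s\<bar> * \<bar>t - s\<bar>"
      by (metis power2_abs power2_eq_square)
    then have "K * (t - s)\<^sup>2 / \<bar>t - s\<bar> = K * \<bar>t - s\<bar>"
      using elim by (metis abs_eq_0 eq_iff_diff_eq_0 mult.assoc nonzero_mult_div_cancel_right)
    ultimately show ?case by simp
  qed
  moreover have "((\<lambda>t. K * \<bar>t - s\<bar>) \<longlongrightarrow> 0) (at s)"
    by (auto intro!: tendsto_eq_intros)
  ultimately have "((\<lambda>t. (f t - f s) / (t - s) - D) \<longlongrightarrow> 0) (at s)" by (rule Lim_null_comparison)
  then show ?thesis by (simp add: has_field_derivative_iff LIM_zero_iff)
qed

text \<open>The forward equation is a statement about marginal laws, and their dependence on time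
  enters through the Laplace transform; hence a family of measures on the orthant takes the place of
  a process.\<close>

locale nonneg_jump_evolution =
  fixes \<nu> :: "(real ^ 'd) measure" and \<mu> :: "real \<Rightarrow> (real ^ 'd) measure"
  assumes finite_jumps: "finite_measure \<nu>" and sets_jumps [measurable_cong]: "sets \<nu> = sets borel"
    and jumps_nonneg: "AE z in \<nu>. nonneg_vec z"
    and prob_marginal: "0 \<le> t \<Longrightarrow> prob_space (\<mu> t)"
    and sets_marginal [measurable_cong]: "sets (\<mu> t) = sets borel"
    and marginal_nonneg: "0 \<le> t \<Longrightarrow> AE x in \<mu> t. nonneg_vec x"
    and laplace: "0 \<le> t \<Longrightarrow> nonneg_vec \<eta> \<Longrightarrow>
      (\<integral>x. exp (- (\<eta> \<bullet> x)) \<partial>\<mu> t) = exp (- t * bernstein \<nu> \<eta>)"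
begin

sublocale jumps: finite_measure \<nu> by (rule finite_jumps)

text \<open>The generator of the compound Poisson process with jump measure \<nu>.\<close>

definition gen :: "(real ^ 'd \<Rightarrow> real) \<Rightarrow> real ^ 'd \<Rightarrow> real" where
  "gen p x = (\<integral>z. p (x + z) - p x \<partial>\<nu>)"

text \<open>The base point x is arbitrary and not confined to the orthant, so that
  \<open>gen_add\<close> is an equation between functions and \<open>gen\<close> maps exponential
  sums literally to exponential sums.\<close>

lemma integrable_shift_expsum: "expsum p \<Longrightarrow> integrable \<nu> (\<lambda>z. p (x + z))"
proof (induction rule: expsum.induct)
  case (exp \<eta> a)
  show ?case
  proof (rule jumps.integrable_const_bound)
    show "AE z in \<nu>. norm (a * exp (- (\<eta> \<bullet> (x + z)))) \<le> \<bar>a\<bar> * exp (- (\<eta> \<bullet> x))"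
      using jumps_nonneg
    proof eventually_elim
      case (elim z)
      then show ?case using exp nonneg_vec_inner[of \<eta> z] by (simp add: abs_mult inner_add_right mult_left_mono)
    qed
  qed simp
qed simp

text \<open>Exponentials turn the shift by z into a factor, so they are eigenfunctions of
  \<open>gen\<close>, with minus the Bernstein function as eigenvalue. This is the rate at which the
  Laplace transform changes in time.\<close>

lemma gen_exp:
  "gen (\<lambda>x. a * exp (- (\<eta> \<bullet> x))) = (\<lambda>x. (- a * bernstein \<nu> \<eta>) * exp (- (\<eta> \<bullet> x)))"
proof
  fix x
  have "gen (\<lambda>x. a * exp (- (\<eta> \<bullet> x))) x = (\<integral>z. - a * exp (- (\<eta> \<bullet> x)) * (1 - exp (- (\<eta> \<bullet> z))) \<partial>\<nu>)"
    unfolding gen_def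
  proof (intro Bochner_Integration.integral_cong refl)
    fix z
    have "exp (- (\<eta> \<bullet> (x + z))) = exp (- (\<eta> \<bullet> x)) * exp (- (\<eta> \<bullet> z))"
      by (simp add: inner_add_right flip: exp_add)
    then show "a * exp (- (\<eta> \<bullet> (x + z))) - a * exp (- (\<eta> \<bullet> x))
      = - a * exp (- (\<eta> \<bullet> x)) * (1 - exp (- (\<eta> \<bullet> z)))"
      by (simp add: algebra_simps)
  qed
  then show "gen (\<lambda>x. a * exp (- (\<eta> \<bullet> x))) x = (- a * bernstein \<nu> \<eta>) * exp (- (\<eta> \<bullet> x))"
    by (simp add: bernstein_def)
qed

lemma gen_add:
  assumes "expsum p" "expsum q"
  shows "gen (\<lambda>x. p x + q x) = (\<lambda>x. gen p x + gen q x)"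
  using integrable_shift_expsum[OF assms(1)] integrable_shift_expsum[OF assms(2)]
  by (simp add: gen_def fun_eq_iff add_diff_add)

lemma expsum_gen: "expsum p \<Longrightarrow> expsum (gen p)"
proof (induction rule: expsum.induct)
  case (exp \<eta> a)
  then show ?case unfolding gen_exp by (rule expsum.exp)
next
  case (add p q)
  show ?case
    unfolding gen_add[OF add(1,2)] by (rule expsum.add[OF add.IH])
qed

lemma gen_bounded:
  fixes p :: "real ^ 'd \<Rightarrow> real"
  assumes "\<And>x. nonneg_vec x \<Longrightarrow> \<bar>p x\<bar> \<le> B" "nonneg_vec x"
  shows "\<bar>gen p x\<bar> \<le> 2 * measure \<nu> (space \<nu>) * B"
proof -
  have B0: "0 \<le> B" using assms(1)[OF assms(2)] by linarith
  have "AE z in \<nu>. norm (p (x + z) - p x) \<le> 2 * B"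
    using jumps_nonneg
  proof eventually_elim
    case (elim z)
    then show ?case
      using assms(1)[OF assms(2)] assms(1)[OF nonneg_vec_add[OF assms(2) elim]] by simp
  qed
  show ?thesis
  proof (cases "integrable \<nu> (\<lambda>z. p (x + z) - p x)")
    case True
    have "\<bar>gen p x\<bar> \<le> (\<integral>z. \<bar>p (x + z) - p x\<bar> \<partial>\<nu>)"
      unfolding gen_def using integral_norm_bound[of \<nu>] by simp
    also have "\<dots> \<le> (\<integral>z. 2 * B \<partial>\<nu>)"
      using True \<open>AE z in \<nu>. _\<close> by (intro integral_mono_AE) auto
    finally show ?thesis by (simp add: mult_ac)
  next
    \<comment> \<open>The integral then has the default value 0, which satisfies the bound.\<close>
    case False
    then show ?thesis using B0 by (simp add: gen_def not_integrable_integral_eq)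
  qed
qed

lemma integrable_marginal:
  fixes p :: "real ^ 'd \<Rightarrow> real"
  assumes "0 \<le> t" "p \<in> borel_measurable borel" "\<And>x. nonneg_vec x \<Longrightarrow> \<bar>p x\<bar> \<le> B"
  shows "integrable (\<mu> t) p"
proof -
  interpret prob_space "\<mu> t" by (rule prob_marginal[OF assms(1)])
  show ?thesis
    using marginal_nonneg[OF assms(1)] assms
    by (intro integrable_const_bound[of _ B]) auto
qed

lemma integral_marginal_bounded:
  fixes p :: "real ^ 'd \<Rightarrow> real"
  assumes "0 \<le> t" "p \<in> borel_measurable borel" "\<And>x. nonneg_vec x \<Longrightarrow> \<bar>p x\<bar> \<le> B"
  shows "\<bar>\<integral>x. p x \<partial>\<mu> t\<bar> \<le> B"
proof -
  interpret prob_space "\<mu> t" by (rule prob_marginal[OF assms(1)])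
  have "\<bar>\<integral>x. p x \<partial>\<mu> t\<bar> \<le> (\<integral>x. \<bar>p x\<bar> \<partial>\<mu> t)"
    using integral_norm_bound[of "\<mu> t" p] by simp
  also have "\<dots> \<le> (\<integral>x. B \<partial>\<mu> t)"
    using integrable_marginal[OF assms] marginal_nonneg[OF assms(1)] assms(3)
    by (intro integral_mono_AE) auto
  finally show ?thesis by (simp add: prob_space)
qed

lemma integrable_marginal_expsum: "expsum p \<Longrightarrow> 0 \<le> t \<Longrightarrow> integrable (\<mu> t) p"
  using expsum_bounded[of p] integrable_marginal[of t p] expsum_measurable[of p] by blast

lemma expsum_derivative:
  assumes "expsum p" "0 < t"
  shows "((\<lambda>u. \<integral>x. p x \<partial>\<mu> u) has_real_derivative (\<integral>x. gen p x \<partial>\<mu> t)) (at t)"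
  using assms(1)
proof (induction rule: expsum.induct)
  case (exp \<eta> a)
  have "((\<lambda>u. a * exp (- u * bernstein \<nu> \<eta>)) has_real_derivative
      - a * bernstein \<nu> \<eta> * exp (- t * bernstein \<nu> \<eta>)) (at t)"
    by (auto intro!: derivative_eq_intros)
  then have "((\<lambda>u. \<integral>x. a * exp (- (\<eta> \<bullet> x)) \<partial>\<mu> u) has_real_derivative
      - a * bernstein \<nu> \<eta> * exp (- t * bernstein \<nu> \<eta>)) (at t)"
    \<comment> \<open>The Laplace formula is given for nonnegative times only, so the two functions
      of u are compared on the open half-line around t.\<close>
    by (rule has_field_derivative_transform_within_open[where S = "{0<..}"])
      (use assms(2) laplace exp in auto)
  then show ?case
    using laplace[of t \<eta>] exp assms(2) unfolding gen_exp by simp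
next
  case (add p q)
  have "integrable (\<mu> t) (gen p)" "integrable (\<mu> t) (gen q)"
    using integrable_marginal_expsum expsum_gen add assms(2) by auto
  then have g: "(\<integral>x. gen (\<lambda>x. p x + q x) x \<partial>\<mu> t) = (\<integral>x. gen p x \<partial>\<mu> t) + (\<integral>x. gen q x \<partial>\<mu> t)"
    unfolding gen_add[OF add(1,2)] by simp
  have "((\<lambda>u. (\<integral>x. p x \<partial>\<mu> u) + (\<integral>x. q x \<partial>\<mu> u)) has_real_derivative
      (\<integral>x. gen p x \<partial>\<mu> t) + (\<integral>x. gen q x \<partial>\<mu> t)) (at t)"
    using add.IH by (rule DERIV_add)
  then show ?case unfolding g
    by (rule has_field_derivative_transform_within_open[where S = "{0<..}"])
      (use assms(2) integrable_marginal_expsum add in auto)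
qed

text \<open>The second derivative in time is the pairing with \<open>gen (gen p)\<close>, and each
  application of \<open>gen\<close> costs a factor of twice the total mass of \<nu>; hence the
  square.\<close>

lemma expsum_second_order:
  assumes p: "expsum p" and B: "\<And>x. nonneg_vec x \<Longrightarrow> \<bar>p x\<bar> \<le> B" and "0 < s" "0 < t"
  shows "\<bar>(\<integral>x. p x \<partial>\<mu> t) - (\<integral>x. p x \<partial>\<mu> s) - (t - s) * (\<integral>x. gen p x \<partial>\<mu> s)\<bar>
    \<le> (2 * measure \<nu> (space \<nu>))\<^sup>2 * B * (t - s)\<^sup>2"
proof (rule second_order_bound)
  fix u :: real assume u: "0 < u"
  show "((\<lambda>u. \<integral>x. p x \<partial>\<mu> u) has_real_derivative (\<integral>x. gen p x \<partial>\<mu> u)) (at u)"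
    by (rule expsum_derivative[OF p u])
  show "((\<lambda>u. \<integral>x. gen p x \<partial>\<mu> u) has_real_derivative (\<integral>x. gen (gen p) x \<partial>\<mu> u)) (at u)"
    by (rule expsum_derivative[OF expsum_gen[OF p] u])
  show "\<bar>\<integral>x. gen (gen p) x \<partial>\<mu> u\<bar> \<le> (2 * measure \<nu> (space \<nu>))\<^sup>2 * B"
  proof (rule integral_marginal_bounded)
    fix x :: "real ^ 'd" assume "nonneg_vec x"
    then have "\<bar>gen (gen p) x\<bar> \<le> 2 * measure \<nu> (space \<nu>) * (2 * measure \<nu> (space \<nu>) * B)"
      by (intro gen_bounded B)
    then show "\<bar>gen (gen p) x\<bar> \<le> (2 * measure \<nu> (space \<nu>))\<^sup>2 * B"
      by (simp add: power2_eq_square mult_ac)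
  qed (use u p in \<open>auto intro: expsum_measurable expsum_gen\<close>)
qed (use assms in auto)

text \<open>Here B + 1 is the common bound of the approximating exponential sums. The pairings with
  \<phi> converge by dominated convergence; the generator term needs it twice, under \<nu> for
  \<open>gen\<close> at a fixed point and then under the law at time s.\<close>

lemma second_order:
  assumes cont: "continuous_on UNIV \<phi>" and B: "\<And>x. \<bar>\<phi> x\<bar> \<le> B" and st: "0 < s" "0 < t"
  shows "\<bar>(\<integral>x. \<phi> x \<partial>\<mu> t) - (\<integral>x. \<phi> x \<partial>\<mu> s) - (t - s) * (\<integral>x. gen \<phi> x \<partial>\<mu> s)\<bar>
    \<le> (2 * measure \<nu> (space \<nu>))\<^sup>2 * (B + 1) * (t - s)\<^sup>2"
proof -
  have [measurable]: "\<phi> \<in> borel_measurable borel"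
    using cont by (rule borel_measurable_continuous_onI)
  obtain p where p: "\<And>n::nat. expsum (p n)"
    and pB: "\<And>n x. nonneg_vec x \<Longrightarrow> \<bar>p n x\<bar> \<le> B + 1"
    and lim: "\<And>x. nonneg_vec x \<Longrightarrow> (\<lambda>n. p n x) \<longlonglongrightarrow> \<phi> x"
    using expsum_approx[OF cont B] by blast
  have [measurable]: "p n \<in> borel_measurable borel" for n by (rule expsum_measurable[OF p])
  have gm [measurable]: "gen f \<in> borel_measurable borel" if [measurable]: "f \<in> borel_measurable borel" for f
    unfolding gen_def[abs_def] by measurable
  have plim: "(\<lambda>n. \<integral>x. p n x \<partial>\<mu> u) \<longlonglongrightarrow> (\<integral>x. \<phi> x \<partial>\<mu> u)" if u: "0 < u" for u
  proof (rule integral_dominated_convergence)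
    interpret prob_space "\<mu> u" using u by (intro prob_marginal) simp
    show "integrable (\<mu> u) (\<lambda>x. B + 1)" by simp
    show "AE x in \<mu> u. (\<lambda>n. p n x) \<longlonglongrightarrow> \<phi> x"
      using marginal_nonneg[of u] u lim by auto
    show "AE x in \<mu> u. norm (p n x) \<le> B + 1" for n
      using marginal_nonneg[of u] u pB by auto
  qed auto
  have gen_lim: "(\<lambda>n. gen (p n) x) \<longlonglongrightarrow> gen \<phi> x" if x: "nonneg_vec x" for x
    unfolding gen_def
  proof (rule integral_dominated_convergence)
    show "integrable \<nu> (\<lambda>z. 2 * (B + 1))" by simp
    show "AE z in \<nu>. (\<lambda>n. p n (x + z) - p n x) \<longlonglongrightarrow> \<phi> (x + z) - \<phi> x"
      using jumps_nonneg
      by eventually_elim (intro tendsto_diff lim nonneg_vec_add x)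
    show "AE z in \<nu>. norm (p n (x + z) - p n x) \<le> 2 * (B + 1)" for n
      using jumps_nonneg
    proof eventually_elim
      case (elim z)
      show ?case using pB[OF x, of n] pB[OF nonneg_vec_add[OF x elim], of n] by simp
    qed
  qed auto
  have glim: "(\<lambda>n. \<integral>x. gen (p n) x \<partial>\<mu> s) \<longlonglongrightarrow> (\<integral>x. gen \<phi> x \<partial>\<mu> s)"
  proof (rule integral_dominated_convergence)
    interpret prob_space "\<mu> s" using st by (intro prob_marginal) simp
    show "integrable (\<mu> s) (\<lambda>x. 2 * measure \<nu> (space \<nu>) * (B + 1))" by simp
    show "AE x in \<mu> s. (\<lambda>n. gen (p n) x) \<longlonglongrightarrow> gen \<phi> x"
      using marginal_nonneg[of s] st gen_lim by auto
    show "AE x in \<mu> s. norm (gen (p n) x) \<le> 2 * measure \<nu> (space \<nu>) * (B + 1)" for n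
      using marginal_nonneg[of s] st gen_bounded[OF pB] by auto
  qed auto
  show ?thesis
  proof (rule tendsto_upperbound)
    show "(\<lambda>n. \<bar>(\<integral>x. p n x \<partial>\<mu> t) - (\<integral>x. p n x \<partial>\<mu> s) - (t - s) * (\<integral>x. gen (p n) x \<partial>\<mu> s)\<bar>)
      \<longlonglongrightarrow> \<bar>(\<integral>x. \<phi> x \<partial>\<mu> t) - (\<integral>x. \<phi> x \<partial>\<mu> s) - (t - s) * (\<integral>x. gen \<phi> x \<partial>\<mu> s)\<bar>"
      by (intro tendsto_intros plim glim st)
    show "\<forall>\<^sub>F n in sequentially.
        \<bar>(\<integral>x. p n x \<partial>\<mu> t) - (\<integral>x. p n x \<partial>\<mu> s) - (t - s) * (\<integral>x. gen (p n) x \<partial>\<mu> s)\<bar>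
        \<le> (2 * measure \<nu> (space \<nu>))\<^sup>2 * (B + 1) * (t - s)\<^sup>2"
      by (intro always_eventually allI expsum_second_order p pB st)
  qed simp
qed

text \<open>Fubini moves \<nu> to the outside, so that the jump measure is applied to one function
  of z. In this order the spherical representation of \<nu> can be inserted and each direction
  treated separately.\<close>

lemma kolmogorov_forward:
  assumes cont: "continuous_on UNIV \<phi>" and B: "\<And>x. \<bar>\<phi> x\<bar> \<le> B" and t: "0 < t"
  shows "((\<lambda>u. \<integral>x. \<phi> x \<partial>\<mu> u) has_real_derivative
    (\<integral>z. (\<integral>x. \<phi> (x + z) \<partial>\<mu> t) - (\<integral>x. \<phi> x \<partial>\<mu> t) \<partial>\<nu>)) (at t)"
proof -
  have [measurable]: "\<phi> \<in> borel_measurable borel"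
    using cont by (rule borel_measurable_continuous_onI)
  interpret \<mu>t: prob_space "\<mu> t" using t by (intro prob_marginal) simp
  interpret pair_sigma_finite "\<mu> t" \<nu> ..
  interpret P: finite_measure "\<mu> t \<Otimes>\<^sub>M \<nu>"
    by (intro finite_measure_pair_measure) (unfold_locales)
  have bd: "norm (\<phi> (x + z) - \<phi> x) \<le> 2 * B" for x z
    using B[of "x + z"] B[of x] by simp
  have "integrable (\<mu> t \<Otimes>\<^sub>M \<nu>) (\<lambda>(x, z). \<phi> (x + z) - \<phi> x)"
  proof (rule P.integrable_const_bound[where B = "2 * B"])
    show "AE q in \<mu> t \<Otimes>\<^sub>M \<nu>. norm (case q of (x, z) \<Rightarrow> \<phi> (x + z) - \<phi> x) \<le> 2 * B"
      using bd by auto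
  qed measurable
  from Fubini_integral[OF this]
  have "(\<integral>x. gen \<phi> x \<partial>\<mu> t) = (\<integral>z. (\<integral>x. \<phi> (x + z) - \<phi> x \<partial>\<mu> t) \<partial>\<nu>)"
    by (simp add: gen_def)
  also have "\<dots> = (\<integral>z. (\<integral>x. \<phi> (x + z) \<partial>\<mu> t) - (\<integral>x. \<phi> x \<partial>\<mu> t) \<partial>\<nu>)"
    using integrable_marginal[of t \<phi> B] integrable_marginal[of t "\<lambda>x. \<phi> (x + _)" B] B t
    by (intro Bochner_Integration.integral_cong refl Bochner_Integration.integral_diff) auto
  finally have "(\<integral>x. gen \<phi> x \<partial>\<mu> t) = \<dots>" .
  moreover have "((\<lambda>u. \<integral>x. \<phi> x \<partial>\<mu> u) has_real_derivative (\<integral>x. gen \<phi> x \<partial>\<mu> t)) (at t)"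
    using second_order[OF cont B t] by (rule has_real_derivative_of_second_order_bound[OF t])
  ultimately show ?thesis by simp
qed

end

section \<open>The Levy measure in spherical variables\<close>

lemma exp_neg_mult_lipschitz:
  fixes s :: real
  assumes "0 \<le> s"
  shows "s-lipschitz_on {0..} (\<lambda>r. exp (- s * r))"
proof (rule lipschitz_onI)
  have *: "\<bar>exp (- s * x) - exp (- s * y)\<bar> \<le> s * \<bar>x - y\<bar>" if "0 \<le> x" "x \<le> y" for x y
  proof -
    have "exp (- s * x) - exp (- s * y) = exp (- s * x) * (1 - exp (- s * (y - x)))"
      by (simp add: right_diff_distrib flip: exp_add)
    moreover have "1 - exp (- s * (y - x)) \<le> s * (y - x)"
      using exp_ge_add_one_self[of "- s * (y - x)"] by linarith
    moreover have "0 \<le> 1 - exp (- s * (y - x))" "exp (- s * x) \<le> 1"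
      using assms that by (auto simp: mult_nonneg_nonneg)
    ultimately have "0 \<le> exp (- s * x) - exp (- s * y)" "exp (- s * x) - exp (- s * y) \<le> 1 * (s * (y - x))"
      by (simp, metis mult_mono exp_ge_zero zero_le_one)
    then show ?thesis using that by simp
  qed
  show "dist (exp (- s * x)) (exp (- s * y)) \<le> s * dist x y" if "x \<in> {0..}" "y \<in> {0..}" for x y
    using *[of x y] *[of y x] that
    by (cases "x \<le> y") (auto simp: dist_real_def abs_minus_commute)
qed (use assms in simp)

text \<open>For 0 < \<alpha> < 1 this is Gamma(1 - \<alpha>) / \<alpha>, by partial
  integration.\<close>

definition marchaud_const :: "real \<Rightarrow> real" where
  "marchaud_const \<alpha> = (LBINT r:{0<..}. (1 - exp (- r)) * r powr (- \<alpha> - 1))"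

text \<open>For positive s, scaling r by s extracts the power of s. At s = 0 the integrand vanishes,
  and so does the right side, because \<open>0 powr \<alpha>\<close> is 0.\<close>

lemma marchaud_exp:
  assumes "0 \<le> s"
  shows "(LBINT r:{0<..}. (1 - exp (- s * r)) * r powr (- \<alpha> - 1)) = s powr \<alpha> * marchaud_const \<alpha>"
proof (cases "s = 0")
  case False
  then have s: "0 < s" using assms by simp
  have "marchaud_const \<alpha> = s * (LBINT r. indicator {0<..} (0 + s * r) *\<^sub>R ((1 - exp (- (0 + s * r))) * (0 + s * r) powr (- \<alpha> - 1)))"
    unfolding marchaud_const_def set_lebesgue_integral_def
    using s by (subst lborel_integral_real_affine[of s _ 0]) auto
  also have "\<dots> = (LBINT r. s powr (- \<alpha>) * (indicator {0<..} r *\<^sub>R ((1 - exp (- s * r)) * r powr (- \<alpha> - 1))))"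
    unfolding integral_mult_right_zero[symmetric]
  proof (intro Bochner_Integration.integral_cong refl)
    fix r
    show "s * (indicator {0<..} (0 + s * r) *\<^sub>R ((1 - exp (- (0 + s * r))) * (0 + s * r) powr (- \<alpha> - 1)))
       = s powr (- \<alpha>) * (indicator {0<..} r *\<^sub>R ((1 - exp (- s * r)) * r powr (- \<alpha> - 1)))"
      using s by (cases "0 < r") (auto simp: powr_mult powr_diff zero_less_mult_iff)
  qed
  also have "\<dots> = s powr (- \<alpha>) * (LBINT r:{0<..}. (1 - exp (- s * r)) * r powr (- \<alpha> - 1))"
    unfolding set_lebesgue_integral_def by (rule integral_mult_right_zero)
  finally show ?thesis using s by (simp add: powr_minus field_simps)
qed (simp add: set_lebesgue_integral_def)

text \<open>This makes the constant of the Bernstein function positive. The part of the integral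
  over r \<ge> 1 already contributes at least (1 - 1 / e) / \<alpha>; integrability at both ends is
  proved first, since a divergent integral would have the value 0.\<close>

lemma marchaud_const_pos:
  assumes "0 < \<alpha>" "\<alpha> < 1"
  shows "0 < marchaud_const \<alpha>"
proof -
  let ?g = "\<lambda>r::real. indicator {0<..} r *\<^sub>R ((1 - exp (- r)) * r powr (- \<alpha> - 1))"
  let ?l = "\<lambda>r::real. (1 - exp (- 1)) * (indicator {1..} r *\<^sub>R r powr (- \<alpha> - 1))"
  let ?w = "\<lambda>r::real. indicator {0..1} r *\<^sub>R r powr (- \<alpha>) + indicator {1..} r *\<^sub>R r powr (- \<alpha> - 1)"
  have far: "integrable lborel (\<lambda>r::real. indicator {1..} r *\<^sub>R r powr (- \<alpha> - 1))"
    "(LBINT r. indicator {1..} r *\<^sub>R r powr (- \<alpha> - 1)) = 1 / \<alpha>"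
    using powr_integrable_to_inf[of "- \<alpha> - 1" 1] assms
    by (auto simp: set_integrable_def set_lebesgue_integral_def)
  have w: "integrable lborel ?w"
    using powr_integrable_from_0(1)[of "- \<alpha>" 1] far(1) assms
    by (intro Bochner_Integration.integrable_add) (auto simp: set_integrable_def)
  have g: "integrable lborel ?g"
  proof (rule Bochner_Integration.integrable_bound[OF w])
    show "AE r in lborel. norm (?g r) \<le> norm (?w r)"
    proof (intro AE_I2)
      fix r :: real
      show "norm (?g r) \<le> norm (?w r)"
      proof (cases "0 < r")
        case r: True
        show ?thesis
        proof (cases "r \<le> 1")
          case True
          have "(1 - exp (- r)) * r powr (- \<alpha> - 1) \<le> r * r powr (- \<alpha> - 1)"
            using exp_ge_add_one_self[of "- r"] by (intro mult_right_mono) auto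
          also have "\<dots> = r powr (- \<alpha>)" using r by (simp add: powr_diff)
          also have "\<dots> \<le> ?w r" using True r by simp
          finally show ?thesis using r by (simp add: abs_mult)
        next
          case False
          have "(1 - exp (- r)) * r powr (- \<alpha> - 1) \<le> 1 * r powr (- \<alpha> - 1)"
            by (intro mult_right_mono) auto
          also have "\<dots> \<le> ?w r" using False r by simp
          finally show ?thesis using r by (simp add: abs_mult)
        qed
      qed simp
    qed
  qed simp
  have "0 < (1 - exp (- 1)) * (1 / \<alpha>)" using assms by simp
  also have "\<dots> = (LBINT r. ?l r)" unfolding integral_mult_right_zero far(2) ..
  also have "\<dots> \<le> (LBINT r. ?g r)"
  proof (rule integral_mono)
    show "integrable lborel ?l" by (intro integrable_mult_right far)
    show "?l r \<le> ?g r" for r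
    proof (cases "1 \<le> r")
      case True
      then show ?thesis by (auto intro!: mult_right_mono)
    next
      case False
      then show ?thesis by (auto simp: indicator_def)
    qed
  qed (rule g)
  finally show ?thesis by (simp add: marchaud_const_def set_lebesgue_integral_def)
qed

text \<open>An exponential of r + y factorises, so averaging over y only multiplies it by the
  corrective term. What remains is the Marchaud integral of a pure exponential, which gives the
  power of s.\<close>

lemma shifted_kernel_exp:
  assumes "0 < \<alpha>" "\<alpha> < 1" "0 < \<epsilon>" "0 \<le> s"
  shows "(LBINT \<rho>:{\<epsilon>..}. (1 - exp (- s * \<rho>)) * ((\<rho> - \<epsilon>) powr (- \<alpha>) * (1 / \<rho>)))
    = marchaud_const \<alpha> * (s powr \<alpha> * corrective \<alpha> \<epsilon> s)"
proof -
  let ?f = "\<lambda>r. exp (- s * r)"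
  define \<Psi> where "\<Psi> r = \<alpha> / \<epsilon> powr \<alpha> * (LBINT y:{0..\<epsilon>}. ?f (r + y) * y powr (\<alpha> - 1))" for r
  have \<Psi>: "\<Psi> r = ?f r * corrective \<alpha> \<epsilon> s" for r
  proof -
    have "(LBINT y:{0..\<epsilon>}. ?f (r + y) * y powr (\<alpha> - 1))
        = (LBINT y:{0..\<epsilon>}. ?f r * (exp (- s * y) * y powr (\<alpha> - 1)))"
      by (simp add: distrib_left exp_diff exp_minus divide_inverse mult_ac)
    also have "\<dots> = ?f r * (LBINT y:{0..\<epsilon>}. exp (- s * y) * y powr (\<alpha> - 1))"
      by (rule set_integral_mult_right)
    finally show ?thesis by (simp add: \<Psi>_def corrective_def)
  qed
  have "(LBINT \<rho>:{\<epsilon>..}. (?f 0 - ?f \<rho>) * ((\<rho> - \<epsilon>) powr (- \<alpha>) * (1 / \<rho>)))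
      = (LBINT r:{0<..}. (\<Psi> 0 - \<Psi> r) * r powr (- \<alpha> - 1))"
    unfolding \<Psi>_def
    using assms by (intro marchaud_average_eq[where B = 1 and L = s, symmetric] exp_neg_mult_lipschitz) auto
  also have "\<dots> = (LBINT r:{0<..}. corrective \<alpha> \<epsilon> s * ((1 - ?f r) * r powr (- \<alpha> - 1)))"
    by (simp add: \<Psi> algebra_simps)
  also have "\<dots> = corrective \<alpha> \<epsilon> s * (s powr \<alpha> * marchaud_const \<alpha>)"
    unfolding set_integral_mult_right marchaud_exp[OF assms(4)] ..
  finally show ?thesis by (simp add: mult_ac)
qed

text \<open>All regularity in r comes from the test function and none from the measure, which may
  have atoms. Bounded and Lipschitz are exactly the properties that
  \<open>marchaud_average_eq\<close> asks for.\<close>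

lemma integral_translate_lipschitz_bounded:
  fixes \<mu> :: "'a::euclidean_space measure"
  assumes \<mu>: "finite_measure \<mu>" "sets \<mu> = sets borel" and \<phi>: "test_fun \<phi>"
  obtains K B where "K-lipschitz_on UNIV (\<lambda>r. \<integral>x. \<phi> (x + r *\<^sub>R \<theta>) \<partial>\<mu>)"
    "\<And>r. \<bar>\<integral>x. \<phi> (x + r *\<^sub>R \<theta>) \<partial>\<mu>\<bar> \<le> B"
proof -
  interpret finite_measure \<mu> by (rule \<mu>)
  obtain B where B: "\<And>x. \<bar>\<phi> x\<bar> \<le> B" using \<phi> by (auto simp: bounded_iff test_fun_def)
  obtain L where L: "L-lipschitz_on UNIV \<phi>" using \<phi> by (auto simp: test_fun_def)
  have L0: "0 \<le> L" using L by (rule lipschitz_on_nonneg)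
  have [measurable]: "\<phi> \<in> borel_measurable borel"
    by (intro borel_measurable_continuous_onI lipschitz_on_continuous_on[OF L])
  have [measurable]: "(\<lambda>x. \<phi> (x + v)) \<in> borel_measurable \<mu>" for v
    unfolding measurable_cong_sets[OF \<mu>(2) refl] by measurable
  have int: "integrable \<mu> (\<lambda>x. \<phi> (x + v))" for v
    using B by (intro integrable_const_bound[where B = B]) auto
  let ?m = "measure \<mu> (space \<mu>)"
  show thesis
  proof (rule that[of "?m * (L * norm \<theta>)" "?m * B"])
    fix r
    have "\<bar>\<integral>x. \<phi> (x + r *\<^sub>R \<theta>) \<partial>\<mu>\<bar> \<le> (\<integral>x. \<bar>\<phi> (x + r *\<^sub>R \<theta>)\<bar> \<partial>\<mu>)"
      using integral_norm_bound[of \<mu>] by simp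
    also have "\<dots> \<le> (\<integral>x. B \<partial>\<mu>)" using int B by (intro integral_mono) auto
    finally show "\<bar>\<integral>x. \<phi> (x + r *\<^sub>R \<theta>) \<partial>\<mu>\<bar> \<le> ?m * B" by simp
  next
    show "(?m * (L * norm \<theta>))-lipschitz_on UNIV (\<lambda>r. \<integral>x. \<phi> (x + r *\<^sub>R \<theta>) \<partial>\<mu>)"
    proof (rule lipschitz_onI)
      fix r s :: real
      have "\<bar>(\<integral>x. \<phi> (x + r *\<^sub>R \<theta>) \<partial>\<mu>) - (\<integral>x. \<phi> (x + s *\<^sub>R \<theta>) \<partial>\<mu>)\<bar>
          = \<bar>\<integral>x. \<phi> (x + r *\<^sub>R \<theta>) - \<phi> (x + s *\<^sub>R \<theta>) \<partial>\<mu>\<bar>"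
        using int by simp
      also have "\<dots> \<le> (\<integral>x. \<bar>\<phi> (x + r *\<^sub>R \<theta>) - \<phi> (x + s *\<^sub>R \<theta>)\<bar> \<partial>\<mu>)"
        using integral_norm_bound[of \<mu> "\<lambda>x. \<phi> (x + r *\<^sub>R \<theta>) - \<phi> (x + s *\<^sub>R \<theta>)"] by simp
      also have "\<dots> \<le> (\<integral>x. L * norm \<theta> * \<bar>r - s\<bar> \<partial>\<mu>)"
      proof (rule integral_mono)
        show "\<bar>\<phi> (x + r *\<^sub>R \<theta>) - \<phi> (x + s *\<^sub>R \<theta>)\<bar> \<le> L * norm \<theta> * \<bar>r - s\<bar>" for x
          using lipschitz_onD[OF L, of "x + r *\<^sub>R \<theta>" "x + s *\<^sub>R \<theta>"]
          by (simp add: dist_norm mult_ac flip: scaleR_diff_left)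
      qed (use int in auto)
      finally show "dist (\<integral>x. \<phi> (x + r *\<^sub>R \<theta>) \<partial>\<mu>) (\<integral>x. \<phi> (x + s *\<^sub>R \<theta>) \<partial>\<mu>)
          \<le> ?m * (L * norm \<theta>) * dist r s"
        by (simp add: dist_real_def mult_ac)
    qed (use L0 in simp)
  qed
qed

section \<open>Integration in spherical variables and the evolution of the law\<close>

locale spherical_jumps =
  fixes \<alpha> C \<epsilon> :: real and M :: "(real ^ 'd) measure"
  assumes \<alpha>: "0 < \<alpha>" "\<alpha> < 1" and C: "0 < C" and \<epsilon>: "0 < \<epsilon>"
    and prob_M: "prob_space M" and sets_M: "sets M = sets (restrict_space borel Bplus)"
begin

definition radial :: "real measure" where
  "radial = density lborel (\<lambda>\<rho>. ennreal (C * (\<rho> - \<epsilon>) powr (- \<alpha>) * (1 / \<rho>) * indicator {\<epsilon>..} \<rho>))"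

lemma sets_radial [measurable_cong]: "sets radial = sets borel"
  by (simp add: radial_def)

lemma nu_eps_eq: "nu_eps \<alpha> C \<epsilon> M = distr (radial \<Otimes>\<^sub>M M) borel (\<lambda>(\<rho>, \<theta>). \<rho> *\<^sub>R \<theta>)"
  by (simp add: nu_eps_def radial_def)

lemma space_M: "space M = Bplus"
  using sets_eq_imp_space_eq[OF sets_M] by (simp add: space_restrict_space)

lemma id_measurable_M [measurable]: "(\<lambda>\<theta>. \<theta>) \<in> borel_measurable M"
  using measurable_restrict_space1[of "\<lambda>\<theta>. \<theta>" borel borel Bplus]
  by (simp add: measurable_cong_sets[OF sets_M refl])

lemma scale_measurable [measurable]: "(\<lambda>(\<rho>, \<theta>). \<rho> *\<^sub>R \<theta>) \<in> borel_measurable (radial \<Otimes>\<^sub>M M)"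
  by measurable

lemma kernel_integrable:
  "integrable lborel (\<lambda>\<rho>. C * (\<rho> - \<epsilon>) powr (- \<alpha>) * (1 / \<rho>) * indicator {\<epsilon>..} \<rho>)"
proof -
  have "integrable lborel (\<lambda>\<rho>. C * (indicator {\<epsilon>..} \<rho> *\<^sub>R ((\<rho> - \<epsilon>) powr (- \<alpha>) * (1 / \<rho>))))"
    using shifted_kernel_integrable[OF \<alpha> \<epsilon>] unfolding set_integrable_def by (rule integrable_mult_right)
  then show ?thesis by (simp add: mult_ac)
qed

lemma kernel_nonneg: "0 \<le> C * (\<rho> - \<epsilon>) powr (- \<alpha>) * (1 / \<rho>) * indicator {\<epsilon>..} \<rho>"
  using C \<epsilon> by (auto simp: indicator_def)

lemma finite_radial: "finite_measure radial"
proof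
  have "emeasure radial (space radial)
      = (\<integral>\<^sup>+\<rho>. ennreal (C * (\<rho> - \<epsilon>) powr (- \<alpha>) * (1 / \<rho>) * indicator {\<epsilon>..} \<rho>) \<partial>lborel)"
    unfolding radial_def by (subst emeasure_density) auto
  also have "\<dots> < \<infinity>"
    using kernel_integrable kernel_nonneg by (subst nn_integral_eq_integral) auto
  finally show "emeasure radial (space radial) \<noteq> \<infinity>" by simp
qed

lemma radial_pos: "AE \<rho> in radial. 0 < \<rho>"
  unfolding radial_def using \<epsilon> by (subst AE_density) (auto simp: indicator_def intro!: AE_I2)

sublocale radial: finite_measure radial by (rule finite_radial)
sublocale M: prob_space M by (rule prob_M)
sublocale pair: pair_sigma_finite radial M ..

lemma finite_pair: "finite_measure (radial \<Otimes>\<^sub>M M)"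
  by (intro finite_measure_pair_measure) unfold_locales

lemma finite_nu_eps: "finite_measure (nu_eps \<alpha> C \<epsilon> M)"
  unfolding nu_eps_eq using finite_pair scale_measurable
  by (rule finite_measure.finite_measure_distr)

lemma pair_nonneg: "AE q in radial \<Otimes>\<^sub>M M. nonneg_vec (fst q *\<^sub>R snd q)"
proof -
  have "AE \<rho> in radial. AE \<theta> in M. nonneg_vec (\<rho> *\<^sub>R \<theta>)"
    using radial_pos
  proof eventually_elim
    case (elim \<rho>)
    then show ?case
      by (intro AE_I2) (auto simp: space_M Bplus_def nonneg_vec_def)
  qed
  moreover have "{q \<in> space (radial \<Otimes>\<^sub>M M). nonneg_vec (fst q *\<^sub>R snd q)} \<in> sets (radial \<Otimes>\<^sub>M M)"
    using scale_measurable unfolding case_prod_beta by measurable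
  ultimately show ?thesis
    by (intro pair.AE_pair_measure) auto
qed

lemma nu_eps_nonneg: "AE x in nu_eps \<alpha> C \<epsilon> M. nonneg_vec x"
  unfolding nu_eps_eq using pair_nonneg
  by (subst AE_distr_iff) (auto simp: case_prod_beta)

text \<open>The bound on F is asked on the orthant, where the measure lives, since the integrand 1 -
  exp (- (\<eta> \<bullet> x)) of the Bernstein function is in general unbounded elsewhere. It gives
  integrability on the product space, hence the order with the radial integral inside.\<close>

lemma integral_nu_eps:
  fixes F :: "real ^ 'd \<Rightarrow> real"
  assumes [measurable]: "F \<in> borel_measurable borel" and B: "\<And>x. nonneg_vec x \<Longrightarrow> \<bar>F x\<bar> \<le> B"
  shows "(\<integral>x. F x \<partial>nu_eps \<alpha> C \<epsilon> M)
    = C * (\<integral>\<theta>. (LBINT \<rho>:{\<epsilon>..}. F (\<rho> *\<^sub>R \<theta>) * ((\<rho> - \<epsilon>) powr (- \<alpha>) * (1 / \<rho>))) \<partial>M)"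
proof -
  interpret P: finite_measure "radial \<Otimes>\<^sub>M M" by (rule finite_pair)
  have int: "integrable (radial \<Otimes>\<^sub>M M) (\<lambda>(\<rho>, \<theta>). F (\<rho> *\<^sub>R \<theta>))"
  proof (rule P.integrable_const_bound[where B = B])
    show "AE q in radial \<Otimes>\<^sub>M M. norm (case q of (\<rho>, \<theta>) \<Rightarrow> F (\<rho> *\<^sub>R \<theta>)) \<le> B"
      using pair_nonneg by eventually_elim (use B in \<open>auto simp: case_prod_beta\<close>)
  qed measurable
  have inner: "(\<integral>\<rho>. F (\<rho> *\<^sub>R \<theta>) \<partial>radial)
      = C * (LBINT \<rho>:{\<epsilon>..}. F (\<rho> *\<^sub>R \<theta>) * ((\<rho> - \<epsilon>) powr (- \<alpha>) * (1 / \<rho>)))" for \<theta>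
  proof -
    have "(\<integral>\<rho>. F (\<rho> *\<^sub>R \<theta>) \<partial>radial)
        = (LBINT \<rho>. C * (\<rho> - \<epsilon>) powr (- \<alpha>) * (1 / \<rho>) * indicator {\<epsilon>..} \<rho> * F (\<rho> *\<^sub>R \<theta>))"
      unfolding radial_def using kernel_nonneg by (subst integral_density) auto
    also have "\<dots> = (LBINT \<rho>. C * (indicator {\<epsilon>..} \<rho> *\<^sub>R (F (\<rho> *\<^sub>R \<theta>) * ((\<rho> - \<epsilon>) powr (- \<alpha>) * (1 / \<rho>)))))"
      by (simp add: mult_ac)
    finally show ?thesis unfolding set_lebesgue_integral_def integral_mult_right_zero .
  qed
  from pair.integral_snd[OF int]
  have "(\<integral>x. F x \<partial>nu_eps \<alpha> C \<epsilon> M) = (\<integral>\<theta>. (\<integral>\<rho>. F (\<rho> *\<^sub>R \<theta>) \<partial>radial) \<partial>M)"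
    unfolding nu_eps_eq by (subst integral_distr) (auto simp: case_prod_beta')
  then show ?thesis by (simp add: inner)
qed

lemma bernstein_nu_eps:
  assumes \<eta>: "nonneg_vec \<eta>"
  shows "bernstein (nu_eps \<alpha> C \<epsilon> M) \<eta>
    = C * marchaud_const \<alpha> * (\<integral>\<theta>. (\<theta> \<bullet> \<eta>) powr \<alpha> * corrective \<alpha> \<epsilon> (\<eta> \<bullet> \<theta>) \<partial>M)"
proof -
  have "bernstein (nu_eps \<alpha> C \<epsilon> M) \<eta>
    = C * (\<integral>\<theta>. (LBINT \<rho>:{\<epsilon>..}. (1 - exp (- (\<eta> \<bullet> \<rho> *\<^sub>R \<theta>))) * ((\<rho> - \<epsilon>) powr (- \<alpha>) * (1 / \<rho>))) \<partial>M)"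
    unfolding bernstein_def
  proof (rule integral_nu_eps[where B = 1])
    show "\<bar>1 - exp (- (\<eta> \<bullet> x))\<bar> \<le> 1" if "nonneg_vec x" for x
    proof -
      have "exp (- (\<eta> \<bullet> x)) \<le> 1" using nonneg_vec_inner[OF \<eta> that] by simp
      moreover have "0 \<le> exp (- (\<eta> \<bullet> x))" by simp
      ultimately show ?thesis by linarith
    qed
  qed simp
  also have "(\<integral>\<theta>. (LBINT \<rho>:{\<epsilon>..}. (1 - exp (- (\<eta> \<bullet> \<rho> *\<^sub>R \<theta>))) * ((\<rho> - \<epsilon>) powr (- \<alpha>) * (1 / \<rho>))) \<partial>M)
    = (\<integral>\<theta>. marchaud_const \<alpha> * ((\<theta> \<bullet> \<eta>) powr \<alpha> * corrective \<alpha> \<epsilon> (\<eta> \<bullet> \<theta>)) \<partial>M)"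
  proof (rule Bochner_Integration.integral_cong[OF refl])
    fix \<theta> assume "\<theta> \<in> space M"
    then have "0 \<le> \<eta> \<bullet> \<theta>" using \<eta> by (simp add: space_M Bplus_def nonneg_vec_inner)
    from shifted_kernel_exp[OF \<alpha> \<epsilon> this]
    show "(LBINT \<rho>:{\<epsilon>..}. (1 - exp (- (\<eta> \<bullet> \<rho> *\<^sub>R \<theta>))) * ((\<rho> - \<epsilon>) powr (- \<alpha>) * (1 / \<rho>)))
      = marchaud_const \<alpha> * ((\<theta> \<bullet> \<eta>) powr \<alpha> * corrective \<alpha> \<epsilon> (\<eta> \<bullet> \<theta>))"
      by (simp add: inner_commute mult_ac)
  qed
  finally show ?thesis by simp
qed

text \<open>By duality both operators translate the test function forward along \<theta>, and their
  shifts r and y add up. The composition therefore depends on the measure only through one scalar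
  function of r + y, and \<open>marchaud_average_eq\<close> applies to it. The sign is arranged so
  that the increment of that function over a jump appears, as in the generator.\<close>

lemma gfrac_deriv_gcorr_op:
  fixes \<mu> :: "(real ^ 'd) measure"
  assumes \<mu>: "finite_measure \<mu>" "sets \<mu> = sets borel" and \<phi>: "test_fun \<phi>"
  shows "gfrac_deriv c \<alpha> \<theta> (gcorr_op \<alpha> \<epsilon> \<theta> (gfun_of_measure \<mu>)) \<phi>
    = - c * (LBINT \<rho>:{\<epsilon>..}. ((\<integral>x. \<phi> (x + \<rho> *\<^sub>R \<theta>) \<partial>\<mu>) - (\<integral>x. \<phi> x \<partial>\<mu>)) * ((\<rho> - \<epsilon>) powr (- \<alpha>) * (1 / \<rho>)))"
proof -
  define f where "f r = (\<integral>x. \<phi> (x + r *\<^sub>R \<theta>) \<partial>\<mu>)" for r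
  obtain K B where K: "K-lipschitz_on UNIV f" and B: "\<And>r. \<bar>f r\<bar> \<le> B"
    using integral_translate_lipschitz_bounded[OF \<mu> \<phi>, of \<theta>] unfolding f_def by metis
  have f_meas: "f \<in> borel_measurable borel"
    by (intro borel_measurable_continuous_onI lipschitz_on_continuous_on[OF K])
  have shift: "gtransl r \<theta> (gcorr_op \<alpha> \<epsilon> \<theta> (gfun_of_measure \<mu>)) \<phi>
      = \<alpha> / \<epsilon> powr \<alpha> * (LBINT y:{0..\<epsilon>}. f (r + y) * y powr (\<alpha> - 1))" for r
    by (simp add: gtransl_def gcorr_op_def gfun_of_measure_def f_def algebra_simps)
  have unshift: "gcorr_op \<alpha> \<epsilon> \<theta> (gfun_of_measure \<mu>) \<phi>
      = \<alpha> / \<epsilon> powr \<alpha> * (LBINT y:{0..\<epsilon>}. f (0 + y) * y powr (\<alpha> - 1))"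
    by (simp add: gtransl_def gcorr_op_def gfun_of_measure_def f_def)
  have "gfrac_deriv c \<alpha> \<theta> (gcorr_op \<alpha> \<epsilon> \<theta> (gfun_of_measure \<mu>)) \<phi>
    = c * (LBINT \<rho>:{\<epsilon>..}. (f 0 - f \<rho>) * ((\<rho> - \<epsilon>) powr (- \<alpha>) * (1 / \<rho>)))"
    unfolding gfrac_deriv_def shift unshift
    by (subst marchaud_average_eq[OF \<alpha> \<epsilon> f_meas lipschitz_on_subset[OF K] B]) auto
  also have "(LBINT \<rho>:{\<epsilon>..}. (f 0 - f \<rho>) * ((\<rho> - \<epsilon>) powr (- \<alpha>) * (1 / \<rho>)))
    = - (LBINT \<rho>:{\<epsilon>..}. (f \<rho> - f 0) * ((\<rho> - \<epsilon>) powr (- \<alpha>) * (1 / \<rho>)))"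
    unfolding set_lebesgue_integral_def
    by (subst Bochner_Integration.integral_minus[symmetric])
      (simp add: left_diff_distrib right_diff_distrib diff_divide_distrib)
  finally show ?thesis by (simp add: f_def)
qed

lemma gdensity_derivative:
  fixes P :: "'w measure" and S :: "real \<Rightarrow> 'w \<Rightarrow> real ^ 'd"
  assumes S: "subordinator P S" "has_levy_measure P S (nu_eps \<alpha> C \<epsilon> M)"
    and \<phi>: "test_fun \<phi>" and t: "0 < t" and c: "0 < c"
  shows "((\<lambda>s. gdensity P S s \<phi>) has_real_derivative
    - (C / c) * (\<integral>\<theta>. gfrac_deriv c \<alpha> \<theta> (gcorr_op \<alpha> \<epsilon> \<theta> (gdensity P S t)) \<phi> \<partial>M)) (at t)"
proof -
  obtain B where B: "\<And>x. \<bar>\<phi> x\<bar> \<le> B" using \<phi> by (auto simp: bounded_iff test_fun_def)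
  obtain L where L: "L-lipschitz_on UNIV \<phi>" using \<phi> by (auto simp: test_fun_def)
  have cont: "continuous_on UNIV \<phi>" using L by (rule lipschitz_on_continuous_on)
  then have [measurable]: "\<phi> \<in> borel_measurable borel" by (rule borel_measurable_continuous_onI)
  have levy: "levy_process P S" and mono: "AE w in P. \<forall>i. mono_on {0..} (\<lambda>t. S t w $ i)"
    using S(1) by (auto simp: subordinator_def)
  have P: "prob_space P" and zero: "AE w in P. S 0 w = 0"
    and S_meas [measurable]: "0 \<le> u \<Longrightarrow> S u \<in> borel_measurable P" for u
    using levy by (auto simp: levy_process_def)
  interpret P: prob_space P by (rule P)
  \<comment> \<open>Increasing components that start at 0 put the laws on the orthant, where the
    exponential sums are bounded.\<close>
  have S_nonneg: "AE w in P. nonneg_vec (S u w)" if "0 \<le> u" for u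
    using mono zero
  proof eventually_elim
    case (elim w)
    then have "S 0 w $ i \<le> S u w $ i" for i
      using that by (auto dest!: spec[of _ i] mono_onD[of _ _ 0 u])
    then show ?case using elim by (simp add: nonneg_vec_def)
  qed
  interpret nonneg_jump_evolution "nu_eps \<alpha> C \<epsilon> M" "\<lambda>u. distr P borel (S u)"
  proof (rule nonneg_jump_evolution.intro)
    show "finite_measure (nu_eps \<alpha> C \<epsilon> M)" by (rule finite_nu_eps)
    show "sets (nu_eps \<alpha> C \<epsilon> M) = sets borel" by (simp add: nu_eps_def)
    show "AE z in nu_eps \<alpha> C \<epsilon> M. nonneg_vec z" by (rule nu_eps_nonneg)
    fix u :: real assume u: "0 \<le> u"
    show "prob_space (distr P borel (S u))" using u by (intro P.prob_space_distr) simp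
    show "AE x in distr P borel (S u). nonneg_vec x"
      using S_nonneg[OF u] u by (subst AE_distr_iff) auto
    show "(\<integral>x. exp (- (\<eta> \<bullet> x)) \<partial>distr P borel (S u)) = exp (- u * bernstein (nu_eps \<alpha> C \<epsilon> M) \<eta>)"
      if "nonneg_vec \<eta>" for \<eta>
      using S(2) u that by (subst integral_distr) (auto simp: has_levy_measure_def)
  qed simp
  let ?\<mu> = "distr P borel (S t)"
  interpret \<mu>: prob_space ?\<mu> using t by (intro prob_marginal) simp
  define F where "F z = (\<integral>x. \<phi> (x + z) \<partial>?\<mu>) - (\<integral>x. \<phi> x \<partial>?\<mu>)" for z
  have bd: "\<bar>\<integral>x. \<phi> (x + v) \<partial>?\<mu>\<bar> \<le> B" for v
    using B t by (intro integral_marginal_bounded) auto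
  have FB: "\<bar>F z\<bar> \<le> 2 * B" for z
    using bd[of z] bd[of 0] by (simp add: F_def)
  have [measurable]: "F \<in> borel_measurable borel" unfolding F_def[abs_def] by measurable
  have "((\<lambda>s. gdensity P S s \<phi>) has_real_derivative (\<integral>z. F z \<partial>nu_eps \<alpha> C \<epsilon> M)) (at t)"
    using kolmogorov_forward[OF cont B t] by (simp add: gdensity_def gfun_of_measure_def F_def)
  also have "(\<integral>z. F z \<partial>nu_eps \<alpha> C \<epsilon> M)
    = C * (\<integral>\<theta>. (LBINT \<rho>:{\<epsilon>..}. F (\<rho> *\<^sub>R \<theta>) * ((\<rho> - \<epsilon>) powr (- \<alpha>) * (1 / \<rho>))) \<partial>M)"
    using FB by (intro integral_nu_eps) auto
  \<comment> \<open>The factor - c is introduced under the integral to match the normalisation of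
    \<open>gfrac_deriv\<close>, and dividing it out again produces the constant C / c.\<close>
  also have "\<dots> = - (C / c) * (\<integral>\<theta>. - c * (LBINT \<rho>:{\<epsilon>..}. F (\<rho> *\<^sub>R \<theta>) * ((\<rho> - \<epsilon>) powr (- \<alpha>) * (1 / \<rho>))) \<partial>M)"
    using c by simp
  also have "(\<integral>\<theta>. - c * (LBINT \<rho>:{\<epsilon>..}. F (\<rho> *\<^sub>R \<theta>) * ((\<rho> - \<epsilon>) powr (- \<alpha>) * (1 / \<rho>))) \<partial>M)
    = (\<integral>\<theta>. gfrac_deriv c \<alpha> \<theta> (gcorr_op \<alpha> \<epsilon> \<theta> (gdensity P S t)) \<phi> \<partial>M)"
    unfolding gdensity_def F_def
    using \<phi> \<mu>.finite_measure_axioms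
    by (intro Bochner_Integration.integral_cong refl gfrac_deriv_gcorr_op[symmetric]) (auto simp: space_M)
  finally show ?thesis .
qed

end

section \<open>Convergence of the corrective term and operators as \<epsilon> tends to 0\<close>

lemma powr_average_tendsto:
  fixes F :: "real \<Rightarrow> real"
  assumes "0 < \<alpha>" and F: "F \<in> borel_measurable borel" and lim: "(F \<longlongrightarrow> F 0) (at_right 0)"
  shows "((\<lambda>\<epsilon>. \<alpha> / \<epsilon> powr \<alpha> * (LBINT y:{0..\<epsilon>}. F y * y powr (\<alpha> - 1))) \<longlongrightarrow> F 0) (at_right 0)"
proof (rule tendstoI)
  fix e :: real assume e: "0 < e"
  from tendstoD[OF lim half_gt_zero[OF e]] obtain b where b: "0 < b"
    and close: "\<And>y. 0 < y \<Longrightarrow> y < b \<Longrightarrow> dist (F y) (F 0) < e / 2"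
    unfolding eventually_at_right_field by auto
  have "dist (\<alpha> / \<epsilon> powr \<alpha> * (LBINT y:{0..\<epsilon>}. F y * y powr (\<alpha> - 1))) (F 0) < e"
    if "0 < \<epsilon>" "\<epsilon> < b" for \<epsilon>
  proof -
    have "\<bar>\<alpha> / \<epsilon> powr \<alpha> * (LBINT y:{0..\<epsilon>}. F y * y powr (\<alpha> - 1)) - F 0\<bar> \<le> e / 2"
    proof (rule powr_average_close[OF assms(1) that(1) F])
      show "\<bar>F y - F 0\<bar> \<le> e / 2" if "0 \<le> y" "y \<le> \<epsilon>" for y
        using close[of y] that \<open>\<epsilon> < b\<close> e by (cases "y = 0") (auto simp: dist_real_def)
    qed
    then show ?thesis using e by (simp add: dist_real_def)
  qed
  then show "\<forall>\<^sub>F \<epsilon> in at_right 0. dist (\<alpha> / \<epsilon> powr \<alpha> * (LBINT y:{0..\<epsilon>}. F y * y powr (\<alpha> - 1))) (F 0) < e"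
    unfolding eventually_at_right_field using b by blast
qed

lemma corrective_tendsto:
  assumes "0 < \<alpha>"
  shows "((\<lambda>\<epsilon>. corrective \<alpha> \<epsilon> s) \<longlongrightarrow> 1) (at_right 0)"
proof -
  have "((\<lambda>y. exp (- s * y)) \<longlongrightarrow> exp (- s * 0)) (at_right 0)"
    by (intro tendsto_intros)
  then show ?thesis
    using powr_average_tendsto[OF assms, of "\<lambda>y. exp (- s * y)"]
    by (simp add: corrective_def)
qed

lemma corr_op_tendsto:
  fixes h :: "'a::euclidean_space \<Rightarrow> real"
  assumes "0 < \<alpha>" and [measurable]: "h \<in> borel_measurable borel" and "isCont h x"
  shows "((\<lambda>\<epsilon>. corr_op \<alpha> \<epsilon> \<theta> h x) \<longlongrightarrow> h x) (at_right 0)"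
proof -
  have "((\<lambda>y. x - y *\<^sub>R \<theta>) \<longlongrightarrow> x - 0 *\<^sub>R \<theta>) (at_right 0)"
    by (intro tendsto_intros)
  then have "((\<lambda>y. h (x - y *\<^sub>R \<theta>)) \<longlongrightarrow> h x) (at_right 0)"
    using isCont_tendsto_compose[OF assms(3)] by simp
  then show ?thesis
    using powr_average_tendsto[OF assms(1), of "\<lambda>y. h (x - y *\<^sub>R \<theta>)"]
    by (simp add: corr_op_def transl_def)
qed

text \<open>One modulus of continuity serves all base points, so the bound of
  \<open>powr_average_close\<close> holds with the same threshold for \<epsilon> at every x.\<close>

lemma corr_op_uniform_limit:
  fixes h :: "'a::euclidean_space \<Rightarrow> real"
  assumes "0 < \<alpha>" and h: "uniformly_continuous_on UNIV h"
  shows "uniform_limit UNIV (\<lambda>\<epsilon>. corr_op \<alpha> \<epsilon> \<theta> h) h (at_right 0)"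
proof (rule uniform_limitI)
  fix e :: real assume e: "0 < e"
  have [measurable]: "h \<in> borel_measurable borel"
    by (intro borel_measurable_continuous_onI uniformly_continuous_imp_continuous h)
  obtain d where d: "0 < d" and close: "\<And>x x'. dist x' x < d \<Longrightarrow> dist (h x') (h x) < e / 2"
    using h half_gt_zero[OF e] unfolding uniformly_continuous_on_def by (metis UNIV_I)
  \<comment> \<open>With \<open>norm \<theta> + 1\<close> in the denominator the quotient makes
    sense for \<theta> = 0 too, and shifts by less than b times \<theta> are strictly shorter than
    d.\<close>
  define b where "b = d / (norm \<theta> + 1)"
  have b: "0 < b" using d by (simp add: b_def add_nonneg_pos)
  have "dist (corr_op \<alpha> \<epsilon> \<theta> h x) (h x) < e" if "0 < \<epsilon>" "\<epsilon> < b" for \<epsilon> x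
  proof -
    have "\<bar>\<alpha> / \<epsilon> powr \<alpha> * (LBINT y:{0..\<epsilon>}. h (x - y *\<^sub>R \<theta>) * y powr (\<alpha> - 1)) - h x\<bar> \<le> e / 2"
    proof (rule powr_average_close[OF assms(1) that(1)])
      fix y assume y: "0 \<le> y" "y \<le> \<epsilon>"
      have "y * norm \<theta> \<le> b * norm \<theta>" using y that by (intro mult_right_mono) auto
      also have "\<dots> < b * (norm \<theta> + 1)" using b by (intro mult_strict_left_mono) auto
      also have "\<dots> = d" using norm_ge_zero[of \<theta>] unfolding b_def by (simp add: add_nonneg_eq_0_iff)
      finally show "\<bar>h (x - y *\<^sub>R \<theta>) - h x\<bar> \<le> e / 2"
        using close[of "x - y *\<^sub>R \<theta>" x] y by (simp add: dist_norm less_imp_le)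
    qed simp
    then show ?thesis using e by (simp add: corr_op_def transl_def dist_real_def)
  qed
  then show "\<forall>\<^sub>F \<epsilon> in at_right 0. \<forall>x\<in>UNIV. dist (corr_op \<alpha> \<epsilon> \<theta> h x) (h x) < e"
    unfolding eventually_at_right_field using b by blast
qed

text \<open>Pairing first with the measure reduces the claim to a scalar average of y \<mapsto>
  \<integral> \<phi> (x + y \<theta>) d\<mu>, which is continuous at 0 because \<phi> is Lipschitz.
  This is the sense of convergence that applies to laws with an atom.\<close>

lemma gcorr_op_tendsto:
  fixes \<mu> :: "'a::euclidean_space measure"
  assumes "0 < \<alpha>" and \<mu>: "finite_measure \<mu>" "sets \<mu> = sets borel" and \<phi>: "test_fun \<phi>"
  shows "((\<lambda>\<epsilon>. gcorr_op \<alpha> \<epsilon> \<theta> (gfun_of_measure \<mu>) \<phi>) \<longlongrightarrow> gfun_of_measure \<mu> \<phi>) (at_right 0)"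
proof -
  define F where "F y = (\<integral>x. \<phi> (x + y *\<^sub>R \<theta>) \<partial>\<mu>)" for y
  obtain K where "K-lipschitz_on UNIV F"
    using integral_translate_lipschitz_bounded[OF \<mu> \<phi>, of \<theta>] unfolding F_def by metis
  then have cont: "continuous_on UNIV F" by (rule lipschitz_on_continuous_on)
  then have [measurable]: "F \<in> borel_measurable borel" by (rule borel_measurable_continuous_onI)
  have "(F \<longlongrightarrow> F 0) (at_right 0)"
    using cont by (auto simp: continuous_on_def intro: tendsto_within_subset)
  then show ?thesis
    using powr_average_tendsto[OF assms(1), of F]
    by (simp add: gcorr_op_def gtransl_def gfun_of_measure_def F_def)
qed

text \<open>Both constants are chosen before \<epsilon>, and they differ from each other. The
  normalisation c of the fractional derivative is a parameter, so the evolution equation holds for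
  every positive choice of it. Convergence to the identity appears in three senses: at continuity
  points, uniformly, and weakly on finite measures; the last one covers
  \<open>gdensity\<close>.\<close>

theorem mainTheorem7:
  fixes \<alpha> C c :: real and M :: "(real ^ 'd) measure"
  assumes "0 < \<alpha>" "\<alpha> < 1" "0 < C" "0 < c"
    and "prob_space M" "sets M = sets (restrict_space borel Bplus)"
  shows
    "(\<exists>k>0. \<forall>\<epsilon>>0. \<forall>\<eta>. nonneg_vec \<eta> \<longrightarrow>
        bernstein (nu_eps \<alpha> C \<epsilon> M) \<eta>
          = k * (\<integral>\<theta>. (\<theta> \<bullet> \<eta>) powr \<alpha> * corrective \<alpha> \<epsilon> (\<eta> \<bullet> \<theta>) \<partial>M)) \<and>
     (\<forall>\<eta> :: real ^ 'd. nonneg_vec \<eta> \<longrightarrow> (\<forall>\<theta>\<in>Bplus.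
        ((\<lambda>\<epsilon>. corrective \<alpha> \<epsilon> (\<eta> \<bullet> \<theta>)) \<longlongrightarrow> 1) (at_right 0))) \<and>
     (\<exists>k>0. \<forall>\<epsilon>>0. \<forall>(P :: 'w measure) S.
        subordinator P S \<and> has_levy_measure P S (nu_eps \<alpha> C \<epsilon> M) \<longrightarrow>
        (\<forall>\<phi> t. test_fun \<phi> \<and> 0 < t \<longrightarrow>
          ((\<lambda>s. gdensity P S s \<phi>) has_real_derivative
             - k * (\<integral>\<theta>. gfrac_deriv c \<alpha> \<theta> (gcorr_op \<alpha> \<epsilon> \<theta> (gdensity P S t)) \<phi> \<partial>M)) (at t))) \<and>
     (\<forall>\<epsilon>>0. \<forall>\<theta>\<in>Bplus. \<forall>(h :: real ^ 'd \<Rightarrow> real) x.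
        corr_op \<alpha> \<epsilon> \<theta> h x
          = \<alpha> / \<epsilon> powr \<alpha> * (LBINT y:{0..\<epsilon>}. h (x - y *\<^sub>R \<theta>) * y powr (\<alpha> - 1))) \<and>
     (\<forall>\<theta>\<in>Bplus. \<forall>(h :: real ^ 'd \<Rightarrow> real) x. h \<in> borel_measurable borel \<and> isCont h x \<longrightarrow>
        ((\<lambda>\<epsilon>. corr_op \<alpha> \<epsilon> \<theta> h x) \<longlongrightarrow> h x) (at_right 0)) \<and>
     (\<forall>\<theta>\<in>Bplus. \<forall>h :: real ^ 'd \<Rightarrow> real. bounded (range h) \<and> uniformly_continuous_on UNIV h \<longrightarrow>
        uniform_limit UNIV (\<lambda>\<epsilon>. corr_op \<alpha> \<epsilon> \<theta> h) h (at_right 0)) \<and>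
     (\<forall>\<theta>\<in>Bplus. \<forall>\<mu> :: (real ^ 'd) measure. finite_measure \<mu> \<and> sets \<mu> = sets borel \<longrightarrow>
        (\<forall>\<phi>. test_fun \<phi> \<longrightarrow>
          ((\<lambda>\<epsilon>. gcorr_op \<alpha> \<epsilon> \<theta> (gfun_of_measure \<mu>) \<phi>) \<longlongrightarrow> gfun_of_measure \<mu> \<phi>) (at_right 0)))"
proof (intro conjI)
  have jumps: "spherical_jumps \<alpha> C \<epsilon> M" if "0 < \<epsilon>" for \<epsilon>
    using assms that by (intro spherical_jumps.intro)
  \<comment> \<open>C is the factor of the Levy kernel, and \<open>marchaud_const \<alpha>\<close>
    comes from integrating an exponential along a ray.\<close>
  show "\<exists>k>0. \<forall>\<epsilon>>0. \<forall>\<eta>. nonneg_vec \<eta> \<longrightarrow>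
      bernstein (nu_eps \<alpha> C \<epsilon> M) \<eta>
        = k * (\<integral>\<theta>. (\<theta> \<bullet> \<eta>) powr \<alpha> * corrective \<alpha> \<epsilon> (\<eta> \<bullet> \<theta>) \<partial>M)"
    using spherical_jumps.bernstein_nu_eps[OF jumps] marchaud_const_pos[OF assms(1,2)] assms(3)
    by (intro exI[of _ "C * marchaud_const \<alpha>"]) auto
  \<comment> \<open>No Gamma factor occurs here: the fractional derivative carries its own kernel,
    so only the ratio of C to its normalisation remains.\<close>
  show "\<exists>k>0. \<forall>\<epsilon>>0. \<forall>(P :: 'w measure) S.
      subordinator P S \<and> has_levy_measure P S (nu_eps \<alpha> C \<epsilon> M) \<longrightarrow>
      (\<forall>\<phi> t. test_fun \<phi> \<and> 0 < t \<longrightarrow>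
        ((\<lambda>s. gdensity P S s \<phi>) has_real_derivative
           - k * (\<integral>\<theta>. gfrac_deriv c \<alpha> \<theta> (gcorr_op \<alpha> \<epsilon> \<theta> (gdensity P S t)) \<phi> \<partial>M)) (at t))"
    using spherical_jumps.gdensity_derivative[OF jumps] assms(3,4)
    by (intro exI[of _ "C / c"]) auto
qed (use assms corrective_tendsto corr_op_tendsto corr_op_uniform_limit gcorr_op_tendsto in
    \<open>auto simp: corr_op_def[abs_def] transl_def\<close>)

end
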